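(* Let $n\ge1$, $1<p<\infty$ and $\gamma\in\mathbb{R}\setminus[0,n]$. For $f\in L^1_{\rm loc}(\mathbb{R}^n)$ and $Q\in\mathcal{D}$ set $b(f)_Q=\ell(Q)^{\gamma/p}O(f,Q)$. Then: (a) the inclusion $\{f:\|f\|_{\mathrm{JN}_p(\mathbb{R}^n,\mathcal{D})}<\infty\}\subset\{f:\|b(f)\|_{l^{p,\infty}_\gamma(\mathbb{R}^n)}<\infty\}$ is proper, and there is no constant $C$ such that $\|f\|_{\mathrm{JN}_p(\mathbb{R}^n,\mathcal{D})}\le C\|b(f)\|_{l^{p,\infty}_\gamma(\mathbb{R}^n)}$ for all $f\in L^1_{\rm loc}(\mathbb{R}^n)$; (b) there is no constant $C$ such that $\|b(f)\|_{l^{p,\infty}_\gamma(\mathbb{R}^n)}\le C\|f\|_{L^{p,\infty}(\mathbb{R}^n)}$ for all $f\in L^1_{\rm loc}(\mathbb{R}^n)$; (c) $\|b(f)\|_{l^{p,\infty}_\gamma(\mathbb{R}^n)}$ is not invariant under rearrangements: there are $f,g\in L^1_{\rm loc}(\mathbb{R}^n)$ such that $|f|$ and $|g|$ have the same distribution function but $\|b(f)\|_{l^{p,\infty}_\gamma(\mathbb{R}^n)}\ne\|b(g)\|_{l^{p,\infty}_\gamma(\mathbb{R}^n)}$.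
   Context: The measure is Lebesgue measure. $\mathcal{D}$ is the collection of half-open dyadic cubes $[j_12^k,(j_1+1)2^k)\times\cdots\times[j_n2^k,(j_n+1)2^k)$, $k\in\mathbb{Z}$, $j\in\mathbb{Z}^n$; $\ell(Q)$ is the sidelength; $O(f,Q)=\frac1{|Q|}\int_Q|f-f_Q|$ with $f_Q=\frac1{|Q|}\int_Qf$. For a sequence $a=\{a_Q\}_{Q\in\mathcal{D}}$, $$\|a\|_{l^{p,\infty}_\gamma(\mathbb{R}^n)}=\Big(\sup_{\lambda>0}\lambda^p\sum_{Q\in\mathcal{D},\,|a_Q|>\lambda}\ell(Q)^{-\gamma}|Q|\Big)^{1/p}.$$ $$\|f\|_{\mathrm{JN}_p(\mathbb{R}^n,\mathcal{D})}=\Big(\sup_{\mathcal{P}}\sum_{Q\in\mathcal{P}}|Q|\,O(f,Q)^p\Big)^{1/p},$$ the supremum over all collections $\mathcal{P}\subset\mathcal{D}$ of pairwise disjoint cubes. $\|f\|_{L^{p,\infty}(\mathbb{R}^n)}=(\sup_{\lambda>0}\lambda^p|\{|f|>\lambda\}|)^{1/p}$. The distribution function of $|f|$ is $\lambda\mapsto|\{|f|>\lambda\}|$, $\lambda>0$. *)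

theory Defs
  imports "HOL-Analysis.Analysis"
begin

section \<open>Dyadic cubes\<close>

definition dyadic_cube :: "int \<Rightarrow> int ^ 'n \<Rightarrow> (real ^ 'n) set" where
  "dyadic_cube k j =
     {x. \<forall>i. real_of_int (j $ i) * 2 powi k \<le> x $ i \<and> x $ i < (real_of_int (j $ i) + 1) * 2 powi k}"

definition dyadic_cubes :: "(real ^ 'n) set set" where
  "dyadic_cubes = {dyadic_cube k j | k j. True}"

text \<open>Sequences are indexed by the cubes themselves, i.e. by sets of points, so the sidelength is
  recovered from the set; this is only meaningful on \<^const>\<open>dyadic_cubes\<close>, where the lemma
  \<open>sidelength_dyadic_cube\<close> below computes it.\<close>

definition sidelength :: "(real ^ 'n) set \<Rightarrow> real" where
  "sidelength Q = (THE l. \<exists>k j. Q = dyadic_cube k j \<and> l = 2 powi k)"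

lemma dyadic_cube_subset_powi_le:
  assumes "dyadic_cube k j \<subseteq> (dyadic_cube k' j' :: (real ^ 'n) set)"
  shows "(2::real) powi k \<le> 2 powi k'"
proof (rule ccontr)
  assume "\<not> ?thesis"
  hence less: "(2::real) powi k' < 2 powi k" by simp
  have pos: "(0::real) < 2 powi k" "(0::real) < 2 powi k'"
    by (simp_all add: zero_less_power_int)
  define x :: "real ^ 'n" where "x = (\<chi> i. real_of_int (j $ i) * 2 powi k)"
  define y :: "real ^ 'n" where "y = (\<chi> i. real_of_int (j $ i) * 2 powi k + 2 powi k')"
  have "x \<in> dyadic_cube k j" "y \<in> dyadic_cube k j"
    using less pos by (auto simp: dyadic_cube_def x_def y_def algebra_simps)
  hence xy: "x \<in> dyadic_cube k' j'" "y \<in> dyadic_cube k' j'"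
    using assms by auto
  fix i :: 'n
  have "real_of_int (j' $ i) * 2 powi k' \<le> x $ i" "y $ i < (real_of_int (j' $ i) + 1) * 2 powi k'"
    using xy by (auto simp: dyadic_cube_def)
  thus False by (simp add: x_def y_def algebra_simps)
qed

lemma sidelength_dyadic_cube: "sidelength (dyadic_cube k j) = 2 powi k"
  unfolding sidelength_def
  by (rule the_equality) (use dyadic_cube_subset_powi_le in \<open>blast intro: antisym\<close>)+

section \<open>Locally integrable functions and mean oscillation\<close>

definition L1_loc :: "(real ^ 'n \<Rightarrow> real) set" where
  "L1_loc = {f. \<forall>K. compact K \<longrightarrow> f absolutely_integrable_on K}"

definition mean_on :: "(real ^ 'n \<Rightarrow> real) \<Rightarrow> (real ^ 'n) set \<Rightarrow> real" where
  "mean_on f Q = (1 / measure lebesgue Q) * (LINT x:Q|lebesgue. f x)"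

definition mean_osc :: "(real ^ 'n \<Rightarrow> real) \<Rightarrow> (real ^ 'n) set \<Rightarrow> real" where
  "mean_osc f Q = mean_on (\<lambda>x. \<bar>f x - mean_on f Q\<bar>) Q"

section \<open>Extended-valued quasinorms\<close>

text \<open>The quasinorms may be infinite, hence they are \<^typ>\<open>ennreal\<close>-valued. The library has no real
  powers on \<^typ>\<open>ennreal\<close>; the following is only used with positive exponents.\<close>

definition ennreal_powr :: "ennreal \<Rightarrow> real \<Rightarrow> ennreal" where
  "ennreal_powr x r = (if x = \<infinity> then \<infinity> else ennreal (enn2real x powr r))"

definition weak_seq_norm :: "real \<Rightarrow> real \<Rightarrow> ((real ^ 'n) set \<Rightarrow> real) \<Rightarrow> ennreal" where
  "weak_seq_norm p \<gamma> a =
     ennreal_powr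
       (SUP t\<in>{0<..}. ennreal (t powr p) *
          (\<Sum>\<^sub>\<infinity>Q\<in>{Q \<in> dyadic_cubes. \<bar>a Q\<bar> > t}.
             ennreal (sidelength Q powr (- \<gamma>) * measure lebesgue Q)))
       (1 / p)"

definition JN_norm :: "real \<Rightarrow> (real ^ 'n \<Rightarrow> real) \<Rightarrow> ennreal" where
  "JN_norm p f =
     ennreal_powr
       (SUP P\<in>{P. P \<subseteq> dyadic_cubes \<and> disjoint P}.
          \<Sum>\<^sub>\<infinity>Q\<in>P. ennreal (measure lebesgue Q * mean_osc f Q powr p))
       (1 / p)"

definition weak_Lp_norm :: "real \<Rightarrow> (real ^ 'n \<Rightarrow> real) \<Rightarrow> ennreal" where
  "weak_Lp_norm p f =
     ennreal_powr
       (SUP t\<in>{0<..}. ennreal (t powr p) * emeasure lebesgue {x. \<bar>f x\<bar> > t})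
       (1 / p)"

definition osc_seq :: "real \<Rightarrow> real \<Rightarrow> (real ^ 'n \<Rightarrow> real) \<Rightarrow> (real ^ 'n) set \<Rightarrow> real" where
  "osc_seq p \<gamma> f Q = sidelength Q powr (\<gamma> / p) * mean_osc f Q"

definition same_distribution :: "(real ^ 'n \<Rightarrow> real) \<Rightarrow> (real ^ 'n \<Rightarrow> real) \<Rightarrow> bool" where
  "same_distribution f g \<longleftrightarrow>
     (\<forall>t>0. emeasure lebesgue {x. \<bar>f x\<bar> > t} = emeasure lebesgue {x. \<bar>g x\<bar> > t})"

end

theory Submission
  imports Defs
begin

text \<open>Since $\gamma\notin[0,n]$, the weights $\ell(Q)^{n-\gamma}$ sum geometrically over all dyadic
  ancestors of a cube if $\gamma>n$, and over all its dyadic descendants if $\gamma<0$. So the sum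
  over a level set $\{Q: b(f)_Q>\lambda\}$ is controlled by the sum over its minimal (respectively
  maximal) cubes. These are pairwise disjoint and hence admissible in the $JN_p$ supremum.

  For the failure of the converse, a lacunary sequence of bumps, one per scale and all contributing
  equally to the $JN_p$ sum, has infinite $JN_p$ norm, whereas its oscillations form a geometric
  progression in the weak sequence norm. For (b) one uses many bumps at each of $K$ scales, balanced
  such that $b(f)_Q$ takes the same value on all of them; the weak sequence norm then grows with $K$.
  For (c) it suffices to change the sign of the constant function $1$ on one dyadic cube.

  The bumps are indicators of a single dyadic child $R$ of a cube $Q$, so that they are constant on
  every dyadic cube that does not properly contain $R$.\<close>

section \<open>Sums over scales and dyadic cubes\<close>

text \<open>The comparison with the $JN_p$ sum is Chebyshev's inequality on one cube at a time: in
  $b(f)_Q^p$ the factor $l(Q)^\<gamma>$ cancels the $l(Q)^{-\<gamma>}$ of the weight and leaves $|Q|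
  O(f,Q)^p$. Only the overlap of the cubes in a level set has to be paid for.

  The difficulty with the lacunary function lies in the cubes $[0,2^k)^n$, which see all smaller
  bumps at once. A bump of scale $2^m$ and height $2^{-mn/p}$ has mass $2^{mn(1-1/p)}$. Since $p >
  1$, these masses grow geometrically, so the largest bump dominates and the oscillation is still of
  order at most $2^{-kn/p}$. The bumps recede from the origin, which secures local integrability.

  In (b), a cube of scale $2^k$ counts with about its measure $2^{kn}$ in the weak $L^p$ norm, but
  with $2^{k(n-\<gamma>)}$ in the sequence norm; the discrepancy $2^{k\<gamma>}$ separates the two.
  The prescribed number of bumps has to be rounded to an integer. Letting the scales increase for
  $\<gamma> > n$ and decrease for $\<gamma> < 0$ keeps that number at least 1, so that rounding
  costs only a factor 2.\<close>

lemma geometric_sum_le_pos: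
  fixes s T :: real and F :: "int set"
  assumes "s > 0" "finite F" "T \<ge> 0" "\<And>k. k \<in> F \<Longrightarrow> 2 powr (real_of_int k * s) \<le> T"
  shows "(\<Sum>k\<in>F. 2 powr (real_of_int k * s)) \<le> T / (1 - 2 powr (- s))"
proof (cases "F = {}")
  case True
  have "2 powr (- s) < 1"
    using powr_less_mono[of "-s" 0 "2::real"] assms by simp
  with True assms show ?thesis by simp
next
  case False
  \<comment> \<open>Factoring out the largest term leaves distinct powers of
    \<open>2 powr (- s)\<close>, hence part of a geometric series.\<close>
  define a where "a = Max F"
  define r :: real where "r = 2 powr (- s)"
  have r: "0 < r" "r < 1"
    using powr_less_mono[of "-s" 0 "2::real"] assms by (simp_all add: r_def)
  have a: "a \<in> F" "\<And>k. k \<in> F \<Longrightarrow> k \<le> a"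
    using False assms(2) by (auto simp: a_def)
  have inj: "inj_on (\<lambda>k. nat (a - k)) F"
    using a(2) by (auto simp: inj_on_def eq_nat_nat_iff)
  have eq: "2 powr (real_of_int k * s) = 2 powr (real_of_int a * s) * r ^ nat (a - k)" if "k \<in> F" for k
  proof -
    have "r ^ nat (a - k) = r powr (real (nat (a - k)))"
      using r by (simp add: powr_realpow)
    also have "real (nat (a - k)) = real_of_int (a - k)"
      using a(2)[OF that] by simp
    also have "r powr real_of_int (a - k) = 2 powr (- s * real_of_int (a - k))"
      by (simp add: r_def powr_powr)
    finally show ?thesis
      by (simp flip: powr_add add: algebra_simps)
  qed
  have "(\<Sum>k\<in>F. 2 powr (real_of_int k * s)) = 2 powr (real_of_int a * s) * (\<Sum>k\<in>F. r ^ nat (a - k))"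
    using eq by (simp add: sum_distrib_left)
  also have "(\<Sum>k\<in>F. r ^ nat (a - k)) = (\<Sum>i\<in>(\<lambda>k. nat (a - k)) ` F. r ^ i)"
    by (simp add: sum.reindex[OF inj])
  also have "\<dots> \<le> (\<Sum>i. r ^ i)"
    using r assms(2) by (intro sum_le_suminf summable_geometric) auto
  also have "\<dots> = 1 / (1 - r)"
    using r by (intro suminf_geometric) auto
  also have "2 powr (real_of_int a * s) * (1 / (1 - r)) \<le> T * (1 / (1 - r))"
    using assms(4)[OF a(1)] r by (intro mult_right_mono) auto
  finally show ?thesis by (simp add: r_def mult_left_mono)
qed

text \<open>A geometric sum is comparable to its largest term, whichever way it grows; negative
  \<open>s\<close> reduces to positive \<open>s\<close> by reflecting the exponents. The hypothesis
  bounds the terms and not the range of \<open>k\<close>, since this is what a level set condition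
  yields, and \<open>C\<close> depends on \<open>s\<close> alone.\<close>

lemma geometric_sum_le:
  fixes s :: real
  assumes "s \<noteq> 0"
  obtains C where "C > 0"
    "\<And>(F::int set) T. finite F \<Longrightarrow> T \<ge> 0 \<Longrightarrow> (\<And>k. k \<in> F \<Longrightarrow> 2 powr (real_of_int k * s) \<le> T) \<Longrightarrow>
       (\<Sum>k\<in>F. 2 powr (real_of_int k * s)) \<le> C * T"
proof
  show "1 / (1 - 2 powr (- \<bar>s\<bar>)) > (0::real)"
    using powr_less_mono[of "-\<bar>s\<bar>" 0 "2::real"] assms by simp
next
  fix F :: "int set" and T :: real
  assume F: "finite F" "T \<ge> 0" "\<And>k. k \<in> F \<Longrightarrow> 2 powr (real_of_int k * s) \<le> T"
  show "(\<Sum>k\<in>F. 2 powr (real_of_int k * s)) \<le> 1 / (1 - 2 powr (- \<bar>s\<bar>)) * T"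
  proof (cases "s > 0")
    case True
    then show ?thesis using geometric_sum_le_pos[OF True F] by simp
  next
    case False
    have "(\<Sum>k\<in>F. 2 powr (real_of_int k * s)) = (\<Sum>k\<in>uminus ` F. 2 powr (real_of_int k * - s))"
      by (subst sum.reindex) (auto simp: inj_on_def)
    also have "\<dots> \<le> T / (1 - 2 powr (- (- s)))"
      using F False assms by (intro geometric_sum_le_pos) auto
    finally show ?thesis using False by simp
  qed
qed

section \<open>Nesting, levels and measures of dyadic cubes\<close>

lemma powi_two_eq_powr: "(2::real) powi k = 2 powr real_of_int k"
  by (simp add: powr_real_of_int')

lemma mem_dyadic_cube:
  "x \<in> dyadic_cube k j \<longleftrightarrow>
     (\<forall>i. real_of_int (j $ i) * 2 powr real_of_int k \<le> x $ i \<and>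
          x $ i < (real_of_int (j $ i) + 1) * 2 powr real_of_int k)"
  by (simp add: dyadic_cube_def powi_two_eq_powr)

lemma dyadic_cube_corner: "(\<chi> i. real_of_int (j $ i) * 2 powr real_of_int k) \<in> dyadic_cube k j"
  by (simp add: mem_dyadic_cube)

lemma dyadic_cube_nonempty: "dyadic_cube k j \<noteq> {}"
  using dyadic_cube_corner by blast

lemma dyadic_cube_in_dyadic_cubes: "dyadic_cube k j \<in> dyadic_cubes"
  by (auto simp: dyadic_cubes_def)

text \<open>In units of the smaller sidelength, all faces of both cubes lie at integers. The strict
  inequalities that a common point provides therefore tighten to the weak ones that containment
  requires.\<close>

lemma dyadic_cube_subset_of_meet:
  assumes "k \<le> k'" "x \<in> dyadic_cube k j" "x \<in> dyadic_cube k' j'"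
  shows "dyadic_cube k j \<subseteq> dyadic_cube k' j'"
proof
  fix y assume y: "y \<in> dyadic_cube k j"
  define d where "d = nat (k' - k)"
  have two: "2 powr real_of_int k' = 2 ^ d * (2::real) powr real_of_int k"
  proof -
    have "real_of_int k' = real d + real_of_int k" using assms(1) by (simp add: d_def)
    then show ?thesis by (simp add: powr_add powr_realpow)
  qed
  show "y \<in> dyadic_cube k' j'"
    unfolding mem_dyadic_cube
  proof
    fix i
    define t where "t = 2 powr real_of_int k"
    have t: "t > 0" by (simp add: t_def)
    have 1: "real_of_int (j $ i) * t \<le> x $ i" "x $ i < (real_of_int (j $ i) + 1) * t"
      "real_of_int (j $ i) * t \<le> y $ i" "y $ i < (real_of_int (j $ i) + 1) * t"
      "real_of_int (j' $ i) * (2 ^ d * t) \<le> x $ i" "x $ i < (real_of_int (j' $ i) + 1) * (2 ^ d * t)"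
      using assms y by (auto simp: mem_dyadic_cube t_def two)
    have "(real_of_int (j' $ i) * 2 ^ d) * t < (real_of_int (j $ i) + 1) * t"
      using 1 by (simp add: algebra_simps)
    then have "real_of_int (j' $ i * 2 ^ d) < real_of_int (j $ i + 1)" using t by simp
    then have "j' $ i * 2 ^ d < j $ i + 1" by (simp only: of_int_less_iff)
    then have a: "real_of_int (j' $ i * 2 ^ d) \<le> real_of_int (j $ i)" by (simp only: of_int_le_iff)
    have "real_of_int (j $ i) * t < ((real_of_int (j' $ i) + 1) * 2 ^ d) * t"
      using 1 by (simp add: algebra_simps)
    then have "real_of_int (j $ i) < real_of_int ((j' $ i + 1) * 2 ^ d)" using t by simp
    then have "j $ i < (j' $ i + 1) * 2 ^ d" by (simp only: of_int_less_iff)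
    then have b: "real_of_int (j $ i + 1) \<le> real_of_int ((j' $ i + 1) * 2 ^ d)" by (simp only: of_int_le_iff)
    have "real_of_int (j' $ i * 2 ^ d) * t \<le> y $ i"
      using mult_right_mono[OF a, of t] t 1 by linarith
    moreover have "y $ i < real_of_int ((j' $ i + 1) * 2 ^ d) * t"
      using mult_right_mono[OF b, of t] t 1 by (simp add: algebra_simps)
    ultimately show "real_of_int (j' $ i) * 2 powr real_of_int k' \<le> y $ i \<and>
        y $ i < (real_of_int (j' $ i) + 1) * 2 powr real_of_int k'"
      by (simp add: two t_def mult.assoc)
  qed
qed

lemma dyadic_cube_inject:
  "dyadic_cube k j = dyadic_cube k' j' \<longleftrightarrow> k = k' \<and> j = j'"
proof
  assume eq: "dyadic_cube k j = dyadic_cube k' j'"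
  have "(2::real) powi k = 2 powi k'"
    using sidelength_dyadic_cube[of k j] sidelength_dyadic_cube[of k' j'] eq by simp
  then have "log 2 (2 powr real_of_int k) = log 2 (2 powr real_of_int k')"
    by (simp add: powi_two_eq_powr)
  then have k: "k = k'" by simp
  have "j $ i = j' $ i" for i
  proof -
    have "(\<chi> i. real_of_int (j $ i) * 2 powr real_of_int k) \<in> dyadic_cube k' j'"
      using dyadic_cube_corner[of j k] by (simp only: eq)
    moreover have "(\<chi> i. real_of_int (j' $ i) * 2 powr real_of_int k') \<in> dyadic_cube k j"
      using dyadic_cube_corner[of j' k'] by (simp only: eq)
    ultimately have *: "real_of_int (j $ i) < real_of_int (j' $ i) + 1" "real_of_int (j' $ i) < real_of_int (j $ i) + 1"
      using k by (simp_all add: mem_dyadic_cube)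
    then show ?thesis by linarith
  qed
  with k show "k = k' \<and> j = j'" by (simp add: vec_eq_iff)
qed auto

text \<open>Sequences are indexed by sets of points, so the scale is read off from the set. On
  dyadic cubes the logarithm is already an integer; the floor only changes its type.\<close>

definition dyadic_level :: "(real ^ 'n) set \<Rightarrow> int" where
  "dyadic_level Q = \<lfloor>log 2 (sidelength Q)\<rfloor>"

lemma dyadic_level_dyadic_cube [simp]: "dyadic_level (dyadic_cube k j) = k"
  by (simp add: dyadic_level_def sidelength_dyadic_cube powi_two_eq_powr)

lemma sidelength_eq_powr_level:
  "Q \<in> dyadic_cubes \<Longrightarrow> sidelength Q = 2 powr real_of_int (dyadic_level Q)"
  by (auto simp: dyadic_cubes_def sidelength_dyadic_cube powi_two_eq_powr)

lemma dyadic_cubes_meet: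
  assumes "Q \<in> dyadic_cubes" "R \<in> dyadic_cubes" "Q \<inter> R \<noteq> {}" "dyadic_level Q \<le> dyadic_level R"
  shows "Q \<subseteq> R"
proof -
  obtain k j k' j' where "Q = dyadic_cube k j" "R = dyadic_cube k' j'"
    using assms by (auto simp: dyadic_cubes_def)
  with assms show ?thesis
    by (auto intro: dyadic_cube_subset_of_meet[THEN subsetD])
qed

lemma dyadic_cubes_nested_or_disjoint:
  assumes "Q \<in> dyadic_cubes" "R \<in> dyadic_cubes"
  shows "Q \<subseteq> R \<or> R \<subseteq> Q \<or> Q \<inter> R = {}"
proof (cases "dyadic_level Q \<le> dyadic_level R")
  case True
  then show ?thesis using dyadic_cubes_meet[OF assms] by blast
next
  case False
  then show ?thesis using dyadic_cubes_meet[OF assms(2,1)] by (auto simp: Int_commute)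
qed

lemma dyadic_level_mono:
  assumes "Q \<in> dyadic_cubes" "R \<in> dyadic_cubes" "Q \<subseteq> R"
  shows "dyadic_level Q \<le> dyadic_level R"
proof -
  obtain k j k' j' where "Q = dyadic_cube k j" "R = dyadic_cube k' j'"
    using assms by (auto simp: dyadic_cubes_def)
  with assms(3) dyadic_cube_subset_powi_le[of k j k' j'] show ?thesis
    by (simp add: powi_two_eq_powr)
qed

lemma
  fixes j :: "int ^ 'n"
  shows lmeasurable_dyadic_cube: "dyadic_cube k j \<in> lmeasurable"
    and measure_dyadic_cube: "measure lebesgue (dyadic_cube k j) = 2 powr (real_of_int k * real CARD('n))"
proof -
  define a b :: "real ^ 'n" where "a = (\<chi> i. real_of_int (j $ i) * 2 powr real_of_int k)"
    and "b = (\<chi> i. (real_of_int (j $ i) + 1) * 2 powr real_of_int k)"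
  have sub: "box a b \<subseteq> dyadic_cube k j" "dyadic_cube k j \<subseteq> cbox a b"
    by (auto simp: mem_box_cart mem_dyadic_cube a_def b_def less_imp_le)
  \<comment> \<open>The half-open cube lies between the open and the closed box with the same
    corners, so it differs from the latter only within the negligible frontier.\<close>
  have neg: "negligible ((cbox a b - dyadic_cube k j) \<union> (dyadic_cube k j - cbox a b))"
    by (rule negligible_subset[OF negligible_frontier_interval[of a b]]) (use sub in auto)
  show "dyadic_cube k j \<in> lmeasurable"
    by (rule lmeasurable_negligible_symdiff[OF lmeasurable_cbox neg])
  have "measure lebesgue (dyadic_cube k j) = measure lebesgue (cbox a b)"
    by (rule measure_negligible_symdiff[OF lmeasurable_cbox neg])
  also have "\<dots> = (\<Prod>i\<in>UNIV. b $ i - a $ i)"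
  proof -
    have "cbox a b \<noteq> {}" using sub dyadic_cube_nonempty by blast
    then show ?thesis by (simp add: content_cbox_cart)
  qed
  also have "\<dots> = (2 powr real_of_int k) ^ CARD('n)"
    by (simp add: a_def b_def algebra_simps)
  also have "\<dots> = 2 powr (real_of_int k * real CARD('n))"
    by (simp add: powr_power mult.commute)
  finally show "measure lebesgue (dyadic_cube k j) = 2 powr (real_of_int k * real CARD('n))" .
qed

lemma dyadic_cubes_lmeasurable: "Q \<in> dyadic_cubes \<Longrightarrow> Q \<in> lmeasurable"
  by (auto simp: dyadic_cubes_def lmeasurable_dyadic_cube)

lemma measure_dyadic_cubes:
  "Q \<in> dyadic_cubes \<Longrightarrow>
     measure lebesgue (Q :: (real ^ 'n) set) = 2 powr (real_of_int (dyadic_level Q) * real CARD('n))"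
  by (auto simp: dyadic_cubes_def measure_dyadic_cube)

text \<open>The child that shares the lower corner of its parent; halving the sidelength doubles the
  integer coordinates of that corner.\<close>

definition dyadic_child :: "int \<Rightarrow> int ^ 'n \<Rightarrow> (real ^ 'n) set" where
  "dyadic_child k j = dyadic_cube (k - 1) (\<chi> i. 2 * j $ i)"

lemma dyadic_child_subset: "dyadic_child k j \<subseteq> dyadic_cube k j"
proof -
  have "2 powr real_of_int k = 2 * 2 powr real_of_int (k - 1)"
    by (simp add: powr_diff)
  then have "(\<chi> i. real_of_int ((\<chi> i. 2 * j $ i) $ i) * 2 powr real_of_int (k - 1)) \<in> dyadic_cube k j"
    by (simp add: mem_dyadic_cube)
  from dyadic_cube_subset_of_meet[OF _ dyadic_cube_corner this] show ?thesis
    by (simp add: dyadic_child_def)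
qed

text \<open>Each new cube is placed beyond the upper endpoints of all previous ones, which is
  possible at any prescribed scale. The cubes sit on the diagonal, so that a single integer fixes
  each position.\<close>

lemma exists_disjoint_dyadic_cubes:
  fixes s :: "'a \<Rightarrow> int"
  assumes "finite I"
  shows "\<exists>J :: 'a \<Rightarrow> int. \<forall>a\<in>I. \<forall>b\<in>I. a \<noteq> b \<longrightarrow>
    dyadic_cube (s a) (vec (J a)) \<inter> (dyadic_cube (s b) (vec (J b)) :: (real ^ 'n) set) = {}"
  using assms
proof (induction I rule: finite_induct)
  case (insert x I)
  then obtain J where J: "\<And>a b. a \<in> I \<Longrightarrow> b \<in> I \<Longrightarrow> a \<noteq> b \<Longrightarrow>
    dyadic_cube (s a) (vec (J a)) \<inter> (dyadic_cube (s b) (vec (J b)) :: (real ^ 'n) set) = {}"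
    by blast
  \<comment> \<open>Absolute values make the sum an upper bound for each single endpoint, also when
    \<open>I\<close> is empty and has no maximum.\<close>
  define B where "B = (\<Sum>a\<in>I. \<bar>(real_of_int (J a) + 1) * 2 powr real_of_int (s a)\<bar>)"
  have B: "(real_of_int (J a) + 1) * 2 powr real_of_int (s a) \<le> B" if "a \<in> I" for a
    using member_le_sum[of a I "\<lambda>a. \<bar>(real_of_int (J a) + 1) * 2 powr real_of_int (s a)\<bar>"] that insert(1)
    by (auto simp: B_def)
  define c where "c = \<lceil>B / 2 powr real_of_int (s x)\<rceil>"
  have c: "B \<le> real_of_int c * 2 powr real_of_int (s x)"
    by (simp add: c_def flip: pos_divide_le_eq)
  have new: "dyadic_cube (s a) (vec (J a)) \<inter> (dyadic_cube (s x) (vec c) :: (real ^ 'n) set) = {}"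
    if "a \<in> I" for a
  proof (rule ccontr)
    assume "\<not> ?thesis"
    then obtain y :: "real ^ 'n" where y: "y \<in> dyadic_cube (s a) (vec (J a))" "y \<in> dyadic_cube (s x) (vec c)"
      by blast
    fix i :: 'n
    have "y $ i < (real_of_int (J a) + 1) * 2 powr real_of_int (s a)"
      "real_of_int c * 2 powr real_of_int (s x) \<le> y $ i"
      using y by (auto simp: mem_dyadic_cube)
    with B[OF that] c show False by linarith
  qed
  have new': "(dyadic_cube (s x) (vec c) :: (real ^ 'n) set) \<inter> dyadic_cube (s a) (vec (J a)) = {}"
    if "a \<in> I" for a using new[OF that] by blast
  show ?case
    by (rule exI[of _ "J(x := c)"]) (use J new new' insert(2) in auto)
qed simp

section \<open>Mean oscillation and the quasinorms\<close>

lemma mean_osc_nonneg: "mean_osc f Q \<ge> 0"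
  by (auto simp: mean_osc_def mean_on_def set_lebesgue_integral_def intro!: mult_nonneg_nonneg integral_nonneg_AE)

lemma mean_osc_cong:
  assumes "\<And>x. x \<in> Q \<Longrightarrow> f x = g x"
  shows "mean_osc f Q = mean_osc g Q"
proof -
  have 1: "(LINT x:Q|lebesgue. h x) = (LINT x:Q|lebesgue. h' x)" if "\<And>x. x \<in> Q \<Longrightarrow> h x = h' x"
    for h h' :: "_ \<Rightarrow> real"
    unfolding set_lebesgue_integral_def
    by (rule Bochner_Integration.integral_cong) (auto simp: indicator_def that)
  have "mean_on f Q = mean_on g Q"
    unfolding mean_on_def using 1[of f g] assms by simp
  then show ?thesis
    unfolding mean_osc_def mean_on_def[of "\<lambda>x. \<bar>_ x - _\<bar>"]
    using assms by (intro arg_cong2[where f = "(*)"] 1) auto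
qed

text \<open>The mean is \<open>b + a * \<theta>\<close>, so the deviation is |a|(1 - \<theta>) on
  \<open>R\<close>, a fraction \<theta> of \<open>Q\<close>, and |a|\<theta> on the remaining
  fraction 1 - \<theta>; both parts contribute equally.\<close>

lemma mean_osc_affine_indicator:
  fixes Q R :: "(real ^ 'n) set"
  assumes QR: "Q \<in> lmeasurable" "R \<in> lmeasurable" "R \<subseteq> Q"
    and Q: "measure lebesgue Q > 0" and \<theta>: "measure lebesgue R = \<theta> * measure lebesgue Q"
  shows "mean_osc (\<lambda>x. b + a * indicator R x) Q = 2 * \<bar>a\<bar> * \<theta> * (1 - \<theta>)"
proof -
  have int: "integrable lebesgue (indicator Q :: _ \<Rightarrow> real)" "integrable lebesgue (indicator R :: _ \<Rightarrow> real)"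
    using QR by (auto simp: integrable_indicator_iff fmeasurable_def)
  have "measure lebesgue R \<le> measure lebesgue Q"
    using QR by (intro measure_mono_fmeasurable) (auto simp: fmeasurable_def)
  with Q have \<theta>01: "0 \<le> \<theta>" "\<theta> \<le> 1"
    using zero_le_mult_iff[of \<theta> "measure lebesgue Q"] by (auto simp flip: \<theta>) (simp add: \<theta>)
  have I: "(LINT x|lebesgue. c * indicator Q x + d * indicator R x) = (c + d * \<theta>) * measure lebesgue Q"
    for c d :: real
    using int QR by (simp add: \<theta> algebra_simps)
  have "(LINT x:Q|lebesgue. b + a * indicator R x) = (LINT x|lebesgue. b * indicator Q x + a * indicator R x)"
    unfolding set_lebesgue_integral_def
    by (rule Bochner_Integration.integral_cong) (use QR(3) in \<open>auto simp: indicator_def\<close>)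
  with I have mean: "mean_on (\<lambda>x. b + a * indicator R x) Q = b + a * \<theta>"
    using Q by (simp add: mean_on_def)
  have "(LINT x:Q|lebesgue. \<bar>b + a * indicator R x - (b + a * \<theta>)\<bar>) =
      (LINT x|lebesgue. \<bar>a\<bar> * \<theta> * indicator Q x + \<bar>a\<bar> * (1 - 2 * \<theta>) * indicator R x)"
    unfolding set_lebesgue_integral_def
  proof (rule Bochner_Integration.integral_cong)
    fix x
    have "\<bar>a - a * \<theta>\<bar> = \<bar>a\<bar> * (1 - \<theta>)" "\<bar>a * \<theta>\<bar> = \<bar>a\<bar> * \<theta>"
      using \<theta>01 abs_mult[of a "1 - \<theta>"] by (auto simp: abs_mult algebra_simps)
    then show "indicator Q x *\<^sub>R \<bar>b + a * indicator R x - (b + a * \<theta>)\<bar> =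
        \<bar>a\<bar> * \<theta> * indicator Q x + \<bar>a\<bar> * (1 - 2 * \<theta>) * indicator R x"
      using QR(3) by (auto simp: indicator_def algebra_simps)
  qed simp
  also have "\<dots> = (\<bar>a\<bar> * \<theta> + \<bar>a\<bar> * (1 - 2 * \<theta>) * \<theta>) * measure lebesgue Q"
    by (rule I)
  also have "\<bar>a\<bar> * \<theta> + \<bar>a\<bar> * (1 - 2 * \<theta>) * \<theta> = 2 * \<bar>a\<bar> * \<theta> * (1 - \<theta>)"
    by (simp add: algebra_simps)
  finally show ?thesis
    using Q unfolding mean_osc_def mean mean_on_def[of "\<lambda>x. \<bar>b + a * indicator R x - _\<bar>"] by simp
qed

lemma mean_osc_const:
  fixes Q :: "(real ^ 'n) set"
  assumes "Q \<in> lmeasurable" "measure lebesgue Q > 0" "\<And>x. x \<in> Q \<Longrightarrow> f x = c"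
  shows "mean_osc f Q = 0"
proof -
  have "mean_osc f Q = mean_osc (\<lambda>x. c + 0 * indicator Q x) Q"
    by (rule mean_osc_cong) (simp add: assms(3))
  also have "\<dots> = 0"
    using mean_osc_affine_indicator[of Q Q 1 c 0] assms by simp
  finally show ?thesis .
qed

text \<open>Meant for cubes that meet bumps of several scales, where no exact formula is at hand.
  The triangle inequality costs the factor 2, because the mean contributes at most as much as the
  function.\<close>

lemma mean_osc_le:
  fixes Q :: "(real ^ 'n) set"
  assumes Q: "Q \<in> lmeasurable" "measure lebesgue Q > 0" and f: "set_integrable lebesgue Q f"
  shows "mean_osc f Q \<le> 2 / measure lebesgue Q * (LINT x:Q|lebesgue. \<bar>f x\<bar>)"
proof -
  define m where "m = mean_on f Q"
  define I where "I = (LINT x:Q|lebesgue. \<bar>f x\<bar>)"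
  have c: "set_integrable lebesgue Q (\<lambda>x. c)" for c :: real
  proof -
    have "integrable lebesgue (indicator Q :: _ \<Rightarrow> real)"
      using Q by (auto simp: integrable_indicator_iff fmeasurable_def)
    from integrable_mult_left[OF this, of c] show ?thesis
      by (auto simp: set_integrable_def)
  qed
  have fa: "set_integrable lebesgue Q (\<lambda>x. \<bar>f x\<bar>)" using f by (rule set_integrable_abs)
  have cI: "(LINT x:Q|lebesgue. c) = c * measure lebesgue Q" for c :: real
    using Q by (simp add: set_lebesgue_integral_def)
  have m: "\<bar>m\<bar> * measure lebesgue Q \<le> I"
  proof -
    have "\<bar>LINT x:Q|lebesgue. f x\<bar> \<le> I"
      using set_integral_norm_bound[OF f] by (simp add: I_def)
    then show ?thesis using Q by (simp add: m_def mean_on_def abs_mult)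
  qed
  have "(LINT x:Q|lebesgue. \<bar>f x - m\<bar>) \<le> (LINT x:Q|lebesgue. \<bar>f x\<bar> + \<bar>m\<bar>)"
    using f fa c by (intro set_integral_mono set_integrable_abs set_integral_diff set_integral_add) auto
  also have "\<dots> = I + \<bar>m\<bar> * measure lebesgue Q"
    using set_integral_add(2)[OF fa c] by (simp add: I_def cI)
  also have "\<dots> \<le> 2 * I" using m by simp
  finally have "(LINT x:Q|lebesgue. \<bar>f x - m\<bar>) / measure lebesgue Q \<le> 2 * I / measure lebesgue Q"
    using Q by (intro divide_right_mono) auto
  then show ?thesis
    by (simp add: mean_osc_def mean_on_def[of "\<lambda>x. \<bar>_ x\<bar>"] m_def I_def)
qed

lemma mean_osc_child:
  obtains \<kappa> where "\<kappa> > 0"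
    "\<And>(f :: real ^ 'n \<Rightarrow> real) a b k j.
       (\<And>x. x \<in> dyadic_cube k j \<Longrightarrow> f x = b + a * indicator (dyadic_child k j) x) \<Longrightarrow>
       mean_osc f (dyadic_cube k j) = \<bar>a\<bar> * \<kappa>"
proof
  \<comment> \<open>A child occupies the fraction 2^(-n) of its parent. Later arguments use only
    that the resulting constant is positive and the same for all cubes.\<close>
  define \<theta> :: real where "\<theta> = 2 powr (- real CARD('n))"
  have \<theta>: "0 < \<theta>" "\<theta> < 1"
    using powr_less_mono[of "- real CARD('n)" 0 "2::real"] by (simp_all add: \<theta>_def)
  then show "2 * \<theta> * (1 - \<theta>) > 0" by simp
  fix f :: "real ^ 'n \<Rightarrow> real" and a b k j
  assume f: "\<And>x. x \<in> dyadic_cube k j \<Longrightarrow> f x = b + a * indicator (dyadic_child k j) x"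
  have "measure lebesgue (dyadic_child k j) = \<theta> * measure lebesgue (dyadic_cube k j)"
    by (simp add: dyadic_child_def measure_dyadic_cube \<theta>_def algebra_simps flip: powr_add)
  moreover have "measure lebesgue (dyadic_cube k j) > 0"
    by (simp add: measure_dyadic_cube)
  ultimately have "mean_osc (\<lambda>x. b + a * indicator (dyadic_child k j) x) (dyadic_cube k j) = 2 * \<bar>a\<bar> * \<theta> * (1 - \<theta>)"
    by (intro mean_osc_affine_indicator dyadic_child_subset)
      (auto simp: dyadic_child_def lmeasurable_dyadic_cube)
  then show "mean_osc f (dyadic_cube k j) = \<bar>a\<bar> * (2 * \<theta> * (1 - \<theta>))"
    using mean_osc_cong[of "dyadic_cube k j" f, OF f] by simp
qed

section \<open>From extended-valued quasinorms to finite real sums\<close>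

lemma ennreal_powr_finite_iff: "ennreal_powr x r < \<infinity> \<longleftrightarrow> x < \<infinity>"
  by (auto simp: ennreal_powr_def less_top)

lemma ennreal_powr_ennreal: "x \<ge> 0 \<Longrightarrow> ennreal_powr (ennreal x) r = ennreal (x powr r)"
  by (simp add: ennreal_powr_def)

lemma ennreal_powr_mono:
  assumes "x \<le> y" "r \<ge> 0"
  shows "ennreal_powr x r \<le> ennreal_powr y r"
proof (cases "y = \<infinity>")
  case False
  then have "x \<noteq> \<infinity>" using assms by (auto simp: top_unique)
  have "enn2real x \<le> enn2real y"
    using assms False by (intro enn2real_mono) (auto simp: less_top)
  with False \<open>x \<noteq> \<infinity>\<close> assms(2) show ?thesis
    by (auto simp: ennreal_powr_def intro!: ennreal_leI powr_mono2)
qed (simp add: ennreal_powr_def)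

lemma sum_le_infsum_ennreal:
  fixes f :: "'a \<Rightarrow> ennreal"
  assumes "finite F" "F \<subseteq> A"
  shows "sum f F \<le> infsum f A"
  using assms by (subst nonneg_infsum_complete) (auto intro!: SUP_upper)

lemma infsum_le_ennreal:
  fixes f :: "'a \<Rightarrow> ennreal"
  assumes "\<And>F. finite F \<Longrightarrow> F \<subseteq> A \<Longrightarrow> sum f F \<le> B"
  shows "infsum f A \<le> B"
  using assms by (subst nonneg_infsum_complete) (auto intro!: SUP_least)

lemma weak_seq_norm_ge:
  assumes "t > 0" "finite F" "F \<subseteq> {Q \<in> dyadic_cubes. \<bar>a Q\<bar> > t}" "p > 0"
  shows "ennreal ((t powr p * (\<Sum>Q\<in>F. sidelength Q powr (- \<gamma>) * measure lebesgue Q)) powr (1 / p))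
           \<le> weak_seq_norm p \<gamma> a"
proof -
  define S where "S = (\<Sum>Q\<in>F. sidelength Q powr (- \<gamma>) * measure lebesgue Q)"
  have S: "S \<ge> 0" unfolding S_def by (intro sum_nonneg) auto
  have "ennreal (t powr p * S) = ennreal (t powr p) * (\<Sum>Q\<in>F. ennreal (sidelength Q powr (- \<gamma>) * measure lebesgue Q))"
    using S by (subst sum_ennreal) (auto simp: S_def ennreal_mult)
  also have "\<dots> \<le> ennreal (t powr p) * (\<Sum>\<^sub>\<infinity>Q\<in>{Q \<in> dyadic_cubes. \<bar>a Q\<bar> > t}.
             ennreal (sidelength Q powr (- \<gamma>) * measure lebesgue Q))"
    using assms by (intro mult_left_mono sum_le_infsum_ennreal) auto
  also have "\<dots> \<le> (SUP t\<in>{0<..}. ennreal (t powr p) * (\<Sum>\<^sub>\<infinity>Q\<in>{Q \<in> dyadic_cubes. \<bar>a Q\<bar> > t}.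
             ennreal (sidelength Q powr (- \<gamma>) * measure lebesgue Q)))"
    using assms by (intro SUP_upper) auto
  finally have "ennreal_powr (ennreal (t powr p * S)) (1 / p) \<le> weak_seq_norm p \<gamma> a"
    unfolding weak_seq_norm_def using assms(4) by (intro ennreal_powr_mono) auto
  then show ?thesis using S by (simp add: ennreal_powr_ennreal S_def)
qed

lemma weak_seq_norm_finiteI:
  assumes "\<And>t F. t > 0 \<Longrightarrow> finite F \<Longrightarrow> F \<subseteq> {Q \<in> dyadic_cubes. \<bar>a Q\<bar> > t} \<Longrightarrow>
     t powr p * (\<Sum>Q\<in>F. sidelength Q powr (- \<gamma>) * measure lebesgue Q) \<le> B"
  shows "weak_seq_norm p \<gamma> a < \<infinity>"
proof -
  have "ennreal (t powr p) * (\<Sum>\<^sub>\<infinity>Q\<in>{Q \<in> dyadic_cubes. \<bar>a Q\<bar> > t}.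
             ennreal (sidelength Q powr (- \<gamma>) * measure lebesgue Q)) \<le> ennreal B" if t: "t > 0" for t
  proof -
    have "(\<Sum>\<^sub>\<infinity>Q\<in>{Q \<in> dyadic_cubes. \<bar>a Q\<bar> > t}.
             ennreal (sidelength Q powr (- \<gamma>) * measure lebesgue Q)) \<le> ennreal (B / t powr p)"
    proof (rule infsum_le_ennreal)
      fix F assume F: "finite F" "F \<subseteq> {Q \<in> dyadic_cubes. \<bar>a Q\<bar> > t}"
      show "(\<Sum>Q\<in>F. ennreal (sidelength Q powr (- \<gamma>) * measure lebesgue Q)) \<le> ennreal (B / t powr p)"
        using assms[OF t F] t by (subst sum_ennreal) (auto intro!: ennreal_leI simp: field_simps)
    qed
    then have "ennreal (t powr p) * (\<Sum>\<^sub>\<infinity>Q\<in>{Q \<in> dyadic_cubes. \<bar>a Q\<bar> > t}.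
             ennreal (sidelength Q powr (- \<gamma>) * measure lebesgue Q)) \<le> ennreal (t powr p) * ennreal (B / t powr p)"
      by (intro mult_left_mono) auto
    also have "\<dots> = ennreal B"
      using t by (subst ennreal_mult'[symmetric]) auto
    finally show ?thesis .
  qed
  then have "(SUP t\<in>{0<..}. ennreal (t powr p) * (\<Sum>\<^sub>\<infinity>Q\<in>{Q \<in> dyadic_cubes. \<bar>a Q\<bar> > t}.
             ennreal (sidelength Q powr (- \<gamma>) * measure lebesgue Q))) \<le> ennreal B"
    by (intro SUP_least) auto
  also have "\<dots> < \<infinity>" by simp
  finally show ?thesis
    unfolding weak_seq_norm_def ennreal_powr_finite_iff .
qed

text \<open>Serves twice: it supplies the bound behind the inclusion, and growing finite sums
  contradict it for the lacunary function.\<close>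

lemma JN_norm_finiteE:
  fixes f :: "real ^ 'n \<Rightarrow> real"
  assumes "JN_norm p f < \<infinity>"
  obtains S where "\<And>F :: (real ^ 'n) set set. finite F \<Longrightarrow> F \<subseteq> dyadic_cubes \<Longrightarrow> disjoint F \<Longrightarrow>
    (\<Sum>Q\<in>F. measure lebesgue Q * mean_osc f Q powr p) \<le> S"
proof -
  define T where "T = (SUP P\<in>{P. P \<subseteq> dyadic_cubes \<and> disjoint P}.
          \<Sum>\<^sub>\<infinity>Q\<in>P. ennreal (measure lebesgue Q * mean_osc f Q powr p))"
  have T: "T < \<infinity>"
    using assms unfolding JN_norm_def ennreal_powr_finite_iff T_def .
  show ?thesis
  proof
    fix F :: "(real ^ 'n) set set"
    assume F: "finite F" "F \<subseteq> dyadic_cubes" "disjoint F"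
    have "ennreal (\<Sum>Q\<in>F. measure lebesgue Q * mean_osc f Q powr p) =
        (\<Sum>\<^sub>\<infinity>Q\<in>F. ennreal (measure lebesgue Q * mean_osc f Q powr p))"
      using F(1) by (subst infsum_finite) (auto simp: sum_ennreal)
    also have "\<dots> \<le> T"
      unfolding T_def by (rule SUP_upper) (use F in auto)
    also have "T = ennreal (enn2real T)" using T by simp
    finally show "(\<Sum>Q\<in>F. measure lebesgue Q * mean_osc f Q powr p) \<le> enn2real T"
      by (simp add: ennreal_le_iff)
  qed
qed

lemma weak_Lp_norm_le:
  assumes "p > 0" "B \<ge> 0" "\<And>t. t > 0 \<Longrightarrow> emeasure lebesgue {x. \<bar>f x\<bar> > t} \<le> ennreal (B / t powr p)"
  shows "weak_Lp_norm p f \<le> ennreal (B powr (1 / p))"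
proof -
  have "ennreal (t powr p) * emeasure lebesgue {x. \<bar>f x\<bar> > t} \<le> ennreal B" if t: "t > 0" for t
  proof -
    have "ennreal (t powr p) * emeasure lebesgue {x. \<bar>f x\<bar> > t} \<le> ennreal (t powr p) * ennreal (B / t powr p)"
      using assms(3)[OF t] by (intro mult_left_mono) auto
    also have "\<dots> = ennreal B"
      using t by (subst ennreal_mult'[symmetric]) auto
    finally show ?thesis .
  qed
  then have "(SUP t\<in>{0<..}. ennreal (t powr p) * emeasure lebesgue {x. \<bar>f x\<bar> > t}) \<le> ennreal B"
    by (intro SUP_least) auto
  then have "weak_Lp_norm p f \<le> ennreal_powr (ennreal B) (1 / p)"
    unfolding weak_Lp_norm_def using assms(1) by (intro ennreal_powr_mono) auto
  then show ?thesis using assms(2) by (simp add: ennreal_powr_ennreal)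
qed

section \<open>The inclusion\<close>

text \<open>After swapping the sums, each \<open>x\<close> is counted once for every related
  \<open>y\<close>, hence at least once.\<close>

lemma sum_le_sum_sum_related:
  fixes w :: "'a \<Rightarrow> real"
  assumes "finite F" "finite M" "\<And>x. x \<in> F \<Longrightarrow> w x \<ge> 0" "\<And>x. x \<in> F \<Longrightarrow> \<exists>y\<in>M. P x y"
  shows "sum w F \<le> (\<Sum>y\<in>M. sum w {x \<in> F. P x y})"
proof -
  have "sum w F \<le> (\<Sum>x\<in>F. \<Sum>y\<in>{y \<in> M. P x y}. w x)"
  proof (rule sum_mono)
    fix x assume x: "x \<in> F"
    then obtain y where "y \<in> M" "P x y" using assms(4) by blast
    then show "w x \<le> (\<Sum>y\<in>{y \<in> M. P x y}. w x)"
      using member_le_sum[of y "{y \<in> M. P x y}" "\<lambda>_. w x"] assms x by auto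
  qed
  also have "\<dots> = (\<Sum>y\<in>M. sum w {x \<in> F. P x y})"
    using assms by (rule_tac sum.swap_restrict)
  finally show ?thesis .
qed

section \<open>Weights of nested families and their extremal cubes\<close>

definition dyadic_weight :: "real \<Rightarrow> (real ^ 'n) set \<Rightarrow> real" where
  "dyadic_weight \<gamma> Q = sidelength Q powr (- \<gamma>) * measure lebesgue Q"

lemma dyadic_weight_nonneg: "dyadic_weight \<gamma> Q \<ge> 0"
  by (simp add: dyadic_weight_def)

lemma dyadic_weight_eq:
  assumes "Q \<in> dyadic_cubes"
  shows "dyadic_weight \<gamma> (Q :: (real ^ 'n) set) = 2 powr (real_of_int (dyadic_level Q) * (real CARD('n) - \<gamma>))"
  using assms
  by (simp add: dyadic_weight_def sidelength_eq_powr_level measure_dyadic_cubes powr_powr algebra_simps flip: powr_add)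

text \<open>Dyadic cubes of equal level that contain \<open>R\<close> meet and thus coincide, so
  there is at most one per level, and no level lies below that of \<open>R\<close>. The weights
  2^(k(n - \<gamma>)) decrease geometrically from \<open>R\<close> upwards.\<close>

lemma ancestors_weight_sum_le:
  assumes "\<gamma> > real CARD('n)"
  obtains C where "C > 0"
    "\<And>(F :: (real ^ 'n) set set) R. finite F \<Longrightarrow> F \<subseteq> dyadic_cubes \<Longrightarrow> R \<in> dyadic_cubes \<Longrightarrow>
      (\<Sum>Q\<in>{Q \<in> F. R \<subseteq> Q}. dyadic_weight \<gamma> Q) \<le> C * dyadic_weight \<gamma> R"
proof -
  define s where "s = real CARD('n) - \<gamma>"
  have s: "s < 0" using assms by (simp add: s_def)
  obtain C where C: "C > 0"
    "\<And>(F::int set) T. finite F \<Longrightarrow> T \<ge> 0 \<Longrightarrow> (\<And>k. k \<in> F \<Longrightarrow> 2 powr (real_of_int k * s) \<le> T) \<Longrightarrow>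
       (\<Sum>k\<in>F. 2 powr (real_of_int k * s)) \<le> C * T"
    using geometric_sum_le[of s] s by auto
  show ?thesis
  proof (rule that[OF C(1)])
    fix F :: "(real ^ 'n) set set" and R :: "(real ^ 'n) set"
    assume F: "finite F" "F \<subseteq> dyadic_cubes" and R: "R \<in> dyadic_cubes"
    let ?A = "{Q \<in> F. R \<subseteq> Q}"
    have inj: "inj_on dyadic_level ?A"
    proof (rule inj_onI)
      fix Q Q' assume Q: "Q \<in> ?A" "Q' \<in> ?A" "dyadic_level Q = dyadic_level Q'"
      moreover have "R \<noteq> {}" using R dyadic_cube_nonempty by (auto simp: dyadic_cubes_def)
      ultimately have "Q \<inter> Q' \<noteq> {}" by blast
      then show "Q = Q'"
        using dyadic_cubes_meet[of Q Q'] dyadic_cubes_meet[of Q' Q] Q F(2) by (auto simp: Int_commute)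
    qed
    have "(\<Sum>Q\<in>?A. dyadic_weight \<gamma> Q) = (\<Sum>Q\<in>?A. 2 powr (real_of_int (dyadic_level Q) * s))"
      using F(2) by (intro sum.cong) (auto simp: dyadic_weight_eq s_def)
    also have "\<dots> = (\<Sum>k\<in>dyadic_level ` ?A. 2 powr (real_of_int k * s))"
      by (simp add: sum.reindex[OF inj])
    also have "\<dots> \<le> C * 2 powr (real_of_int (dyadic_level R) * s)"
    proof (rule C(2))
      fix k assume "k \<in> dyadic_level ` ?A"
      then have "dyadic_level R \<le> k"
        using dyadic_level_mono[OF R] F(2) by auto
      then show "2 powr (real_of_int k * s) \<le> 2 powr (real_of_int (dyadic_level R) * s)"
        using s by (simp add: mult_right_mono_neg)
    qed (use F in auto)
    finally show "(\<Sum>Q\<in>?A. dyadic_weight \<gamma> Q) \<le> C * dyadic_weight \<gamma> R"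
      using R by (simp add: dyadic_weight_eq s_def)
  qed
qed

text \<open>The cubes of level k inside \<open>R\<close> are disjoint and have total measure at most
  |R|, so together they weigh at most 2^(-k\<gamma>) |R|. For negative \<gamma> this decays
  geometrically as the cubes shrink.\<close>

lemma descendants_weight_sum_le:
  assumes "\<gamma> < 0"
  obtains C where "C > 0"
    "\<And>(F :: (real ^ 'n) set set) R. finite F \<Longrightarrow> F \<subseteq> dyadic_cubes \<Longrightarrow> R \<in> dyadic_cubes \<Longrightarrow>
      (\<Sum>Q\<in>{Q \<in> F. Q \<subseteq> R}. dyadic_weight \<gamma> Q) \<le> C * dyadic_weight \<gamma> R"
proof -
  define s where "s = - \<gamma>"
  have s: "s > 0" using assms by (simp add: s_def)
  obtain C where C: "C > 0"
    "\<And>(F::int set) T. finite F \<Longrightarrow> T \<ge> 0 \<Longrightarrow> (\<And>k. k \<in> F \<Longrightarrow> 2 powr (real_of_int k * s) \<le> T) \<Longrightarrow>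
       (\<Sum>k\<in>F. 2 powr (real_of_int k * s)) \<le> C * T"
    using geometric_sum_le[of s] s by auto
  have w: "dyadic_weight \<gamma> Q = 2 powr (real_of_int (dyadic_level Q) * s) * measure lebesgue Q"
    if "Q \<in> dyadic_cubes" for Q :: "(real ^ 'n) set"
    using that by (simp add: dyadic_weight_def sidelength_eq_powr_level powr_powr s_def)
  show ?thesis
  proof (rule that[OF C(1)])
    fix F :: "(real ^ 'n) set set" and R :: "(real ^ 'n) set"
    assume F: "finite F" "F \<subseteq> dyadic_cubes" and R: "R \<in> dyadic_cubes"
    define A where "A = {Q \<in> F. Q \<subseteq> R}"
    have A: "finite A" "A \<subseteq> dyadic_cubes" using F by (auto simp: A_def)
    have level: "(\<Sum>Q\<in>{Q \<in> A. dyadic_level Q = k}. dyadic_weight \<gamma> Q) \<le>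
        2 powr (real_of_int k * s) * measure lebesgue R" for k
    proof -
      let ?B = "{Q \<in> A. dyadic_level Q = k}"
      have disj: "pairwise disjnt ?B"
      proof (rule pairwiseI)
        fix Q Q' assume Q: "Q \<in> ?B" "Q' \<in> ?B" "Q \<noteq> Q'"
        then show "disjnt Q Q'"
          using dyadic_cubes_meet[of Q Q'] dyadic_cubes_meet[of Q' Q] A(2)
          by (auto simp: disjnt_def Int_commute)
      qed
      have meas: "Q \<in> lmeasurable" if "Q \<in> ?B" for Q
        using that A(2) dyadic_cubes_lmeasurable by auto
      have "(\<Sum>Q\<in>?B. dyadic_weight \<gamma> Q) = (\<Sum>Q\<in>?B. 2 powr (real_of_int k * s) * measure lebesgue Q)"
        using A(2) by (intro sum.cong) (auto simp: w)
      also have "\<dots> = 2 powr (real_of_int k * s) * measure lebesgue (\<Union>?B)"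
        using A(1) by (subst measure_Union'[OF _ meas disj]) (auto simp: sum_distrib_left)
      also have "measure lebesgue (\<Union>?B) \<le> measure lebesgue R"
      proof (rule measure_mono_fmeasurable)
        show "\<Union>?B \<in> sets lebesgue"
          using meas A(1) by (intro sets.finite_Union) (auto simp: fmeasurable_def)
        show "R \<in> lmeasurable" by (rule dyadic_cubes_lmeasurable[OF R])
      qed (auto simp: A_def)
      finally show ?thesis by simp
    qed
    have "(\<Sum>Q\<in>A. dyadic_weight \<gamma> Q) =
        (\<Sum>k\<in>dyadic_level ` A. \<Sum>Q\<in>{Q \<in> A. dyadic_level Q = k}. dyadic_weight \<gamma> Q)"
      by (rule sum.image_gen[OF A(1)])
    also have "\<dots> \<le> (\<Sum>k\<in>dyadic_level ` A. 2 powr (real_of_int k * s) * measure lebesgue R)"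
      by (intro sum_mono level)
    also have "\<dots> = (\<Sum>k\<in>dyadic_level ` A. 2 powr (real_of_int k * s)) * measure lebesgue R"
      by (simp add: sum_distrib_right)
    also have "\<dots> \<le> (C * 2 powr (real_of_int (dyadic_level R) * s)) * measure lebesgue R"
    proof (intro mult_right_mono C(2))
      fix k assume "k \<in> dyadic_level ` A"
      then have "k \<le> dyadic_level R"
        using dyadic_level_mono[OF _ R] A(2) by (auto simp: A_def)
      then show "2 powr (real_of_int k * s) \<le> 2 powr (real_of_int (dyadic_level R) * s)"
        using s by (simp add: mult_right_mono)
    qed (use A in auto)
    finally show "(\<Sum>Q\<in>{Q \<in> F. Q \<subseteq> R}. dyadic_weight \<gamma> Q) \<le> C * dyadic_weight \<gamma> R"
      using R by (simp add: w A_def mult.assoc)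
  qed
qed

text \<open>Finiteness of \<open>F\<close> ensures that every member is comparable to an extremal
  one; an infinite nested family may have no minimal or no maximal cube. Since \<open>C\<close> does
  not depend on \<open>F\<close>, the bound survives the passage to infinite level sets.\<close>

lemma disjoint_subfamily_weight:
  assumes "\<gamma> \<notin> {0..real CARD('n)}"
  obtains C where "C > 0"
    "\<And>F :: (real ^ 'n) set set. finite F \<Longrightarrow> F \<subseteq> dyadic_cubes \<Longrightarrow>
      \<exists>M\<subseteq>F. disjoint M \<and> (\<Sum>Q\<in>F. dyadic_weight \<gamma> Q) \<le> C * (\<Sum>Q\<in>M. dyadic_weight \<gamma> Q)"
proof (cases "\<gamma> < 0")
  case True
  obtain C where C: "C > 0"
    "\<And>(F :: (real ^ 'n) set set) R. finite F \<Longrightarrow> F \<subseteq> dyadic_cubes \<Longrightarrow> R \<in> dyadic_cubes \<Longrightarrow>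
      (\<Sum>Q\<in>{Q \<in> F. Q \<subseteq> R}. dyadic_weight \<gamma> Q) \<le> C * dyadic_weight \<gamma> R"
    using descendants_weight_sum_le[OF True] by blast
  show ?thesis
  proof (rule that[OF C(1)])
    fix F :: "(real ^ 'n) set set" assume F: "finite F" "F \<subseteq> dyadic_cubes"
    define M where "M = {R \<in> F. \<forall>Q\<in>F. R \<subseteq> Q \<longrightarrow> R = Q}"
    have cover: "\<exists>R\<in>M. Q \<subseteq> R" if "Q \<in> F" for Q
      using finite_has_maximal2[OF F(1) that] unfolding M_def by blast
    have "disjoint M"
    proof (rule disjointI)
      fix Q R assume "Q \<in> M" "R \<in> M" "Q \<noteq> R"
      moreover from this have "Q \<subseteq> R \<or> R \<subseteq> Q \<or> Q \<inter> R = {}"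
        using F(2) by (intro dyadic_cubes_nested_or_disjoint) (auto simp: M_def)
      ultimately show "Q \<inter> R = {}" unfolding M_def by blast
    qed
    moreover have "(\<Sum>Q\<in>F. dyadic_weight \<gamma> Q) \<le> (\<Sum>R\<in>M. \<Sum>Q\<in>{Q \<in> F. Q \<subseteq> R}. dyadic_weight \<gamma> Q)"
      using F cover by (intro sum_le_sum_sum_related) (auto simp: M_def dyadic_weight_nonneg)
    moreover have "\<dots> \<le> (\<Sum>R\<in>M. C * dyadic_weight \<gamma> R)"
      using F by (intro sum_mono C(2)) (auto simp: M_def)
    moreover have "M \<subseteq> F" by (auto simp: M_def)
    ultimately show "\<exists>M\<subseteq>F. disjoint M \<and> (\<Sum>Q\<in>F. dyadic_weight \<gamma> Q) \<le> C * (\<Sum>Q\<in>M. dyadic_weight \<gamma> Q)"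
      by (intro exI[of _ M]) (auto simp: sum_distrib_left)
  qed
next
  case False
  with assms have "\<gamma> > real CARD('n)" by auto
  then obtain C where C: "C > 0"
    "\<And>(F :: (real ^ 'n) set set) R. finite F \<Longrightarrow> F \<subseteq> dyadic_cubes \<Longrightarrow> R \<in> dyadic_cubes \<Longrightarrow>
      (\<Sum>Q\<in>{Q \<in> F. R \<subseteq> Q}. dyadic_weight \<gamma> Q) \<le> C * dyadic_weight \<gamma> R"
    using ancestors_weight_sum_le by blast
  show ?thesis
  proof (rule that[OF C(1)])
    fix F :: "(real ^ 'n) set set" assume F: "finite F" "F \<subseteq> dyadic_cubes"
    define M where "M = {R \<in> F. \<forall>Q\<in>F. Q \<subseteq> R \<longrightarrow> R = Q}"
    have cover: "\<exists>R\<in>M. R \<subseteq> Q" if "Q \<in> F" for Q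
      using finite_has_minimal2[OF F(1) that] unfolding M_def by blast
    have "disjoint M"
    proof (rule disjointI)
      fix Q R assume "Q \<in> M" "R \<in> M" "Q \<noteq> R"
      moreover from this have "Q \<subseteq> R \<or> R \<subseteq> Q \<or> Q \<inter> R = {}"
        using F(2) by (intro dyadic_cubes_nested_or_disjoint) (auto simp: M_def)
      ultimately show "Q \<inter> R = {}" unfolding M_def by blast
    qed
    moreover have "(\<Sum>Q\<in>F. dyadic_weight \<gamma> Q) \<le> (\<Sum>R\<in>M. \<Sum>Q\<in>{Q \<in> F. R \<subseteq> Q}. dyadic_weight \<gamma> Q)"
      using F cover by (intro sum_le_sum_sum_related) (auto simp: M_def dyadic_weight_nonneg)
    moreover have "\<dots> \<le> (\<Sum>R\<in>M. C * dyadic_weight \<gamma> R)"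
      using F by (intro sum_mono C(2)) (auto simp: M_def)
    moreover have "M \<subseteq> F" by (auto simp: M_def)
    ultimately show "\<exists>M\<subseteq>F. disjoint M \<and> (\<Sum>Q\<in>F. dyadic_weight \<gamma> Q) \<le> C * (\<Sum>Q\<in>M. dyadic_weight \<gamma> Q)"
      by (intro exI[of _ M]) (auto simp: sum_distrib_left)
  qed
qed

lemma weak_seq_norm_finite_if_JN_norm_finite:
  fixes f :: "real ^ 'n \<Rightarrow> real"
  assumes "p > 0" "\<gamma> \<notin> {0..real CARD('n)}" "JN_norm p f < \<infinity>"
  shows "weak_seq_norm p \<gamma> (osc_seq p \<gamma> f) < \<infinity>"
proof -
  obtain C where C: "C > 0"
    "\<And>F :: (real ^ 'n) set set. finite F \<Longrightarrow> F \<subseteq> dyadic_cubes \<Longrightarrow>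
      \<exists>M\<subseteq>F. disjoint M \<and> (\<Sum>Q\<in>F. dyadic_weight \<gamma> Q) \<le> C * (\<Sum>Q\<in>M. dyadic_weight \<gamma> Q)"
    using disjoint_subfamily_weight[OF assms(2)] by blast
  obtain S where S: "\<And>F :: (real ^ 'n) set set. finite F \<Longrightarrow> F \<subseteq> dyadic_cubes \<Longrightarrow> disjoint F \<Longrightarrow>
    (\<Sum>Q\<in>F. measure lebesgue Q * mean_osc f Q powr p) \<le> S"
    using JN_norm_finiteE[OF assms(3)] by blast
  show ?thesis
  proof (rule weak_seq_norm_finiteI)
    fix t :: real and F :: "(real ^ 'n) set set"
    assume t: "t > 0" and F: "finite F" "F \<subseteq> {Q \<in> dyadic_cubes. \<bar>osc_seq p \<gamma> f Q\<bar> > t}"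
    then obtain M where M: "M \<subseteq> F" "disjoint M"
      "(\<Sum>Q\<in>F. dyadic_weight \<gamma> Q) \<le> C * (\<Sum>Q\<in>M. dyadic_weight \<gamma> Q)"
      using C(2)[of F] by blast
    \<comment> \<open>Chebyshev on a single cube: raising the level set condition to the power
      \<open>p\<close> produces l(Q)^\<gamma>, which cancels against the weight.\<close>
    have *: "t powr p * dyadic_weight \<gamma> Q \<le> measure lebesgue Q * mean_osc f Q powr p" if "Q \<in> M" for Q
    proof -
      have Q: "Q \<in> dyadic_cubes" "t < sidelength Q powr (\<gamma> / p) * mean_osc f Q"
        using that M(1) F(2) by (auto simp: osc_seq_def mean_osc_nonneg)
      have l: "sidelength Q > 0" using Q(1) by (simp add: sidelength_eq_powr_level)
      have "t powr p \<le> (sidelength Q powr (\<gamma> / p) * mean_osc f Q) powr p"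
        using t Q(2) assms(1) by (intro powr_mono2) auto
      also have "\<dots> = sidelength Q powr \<gamma> * mean_osc f Q powr p"
        using assms(1) by (simp add: powr_mult powr_powr mean_osc_nonneg)
      finally have "t powr p * dyadic_weight \<gamma> Q \<le> sidelength Q powr \<gamma> * mean_osc f Q powr p * dyadic_weight \<gamma> Q"
        by (intro mult_right_mono dyadic_weight_nonneg)
      also have "\<dots> = measure lebesgue Q * mean_osc f Q powr p"
        using l by (simp add: dyadic_weight_def powr_minus)
      finally show ?thesis .
    qed
    have "t powr p * (\<Sum>Q\<in>F. dyadic_weight \<gamma> Q) \<le> t powr p * (C * (\<Sum>Q\<in>M. dyadic_weight \<gamma> Q))"
      using M(3) by (intro mult_left_mono) auto
    also have "\<dots> = C * (\<Sum>Q\<in>M. t powr p * dyadic_weight \<gamma> Q)"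
      by (simp add: sum_distrib_left algebra_simps)
    also have "\<dots> \<le> C * (\<Sum>Q\<in>M. measure lebesgue Q * mean_osc f Q powr p)"
      using C(1) * by (intro mult_left_mono sum_mono) auto
    also have "\<dots> \<le> C * S"
      using C(1) M F finite_subset[OF M(1)] by (intro mult_left_mono S) auto
    finally show "t powr p * (\<Sum>Q\<in>F. sidelength Q powr (- \<gamma>) * measure lebesgue Q) \<le> C * S"
      by (simp add: dyadic_weight_def)
  qed
qed

section \<open>Lacunary bumps\<close>

text \<open>The indicators of the children of the cubes $[2^{m+1},2^{m+2})^n$, with weights that give each
  of these cubes the same contribution to the $JN_p$ sum. A dyadic cube on which the function is
  not constant is one of these cubes or of the form $[0,2^k)^n$, so every scale is
  represented at most twice.\<close>

definition lacunary_bumps :: "real \<Rightarrow> real ^ 'n \<Rightarrow> real" where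
  "lacunary_bumps p x =
     (\<Sum>m. 2 powr (- real m * real CARD('n) / p) * indicator (dyadic_child (int m + 1) (1)) x)"

abbreviation lacunary_bump :: "nat \<Rightarrow> (real ^ 'n) set" where
  "lacunary_bump m \<equiv> dyadic_child (int m + 1) (1)"

abbreviation lacunary_cube :: "nat \<Rightarrow> (real ^ 'n) set" where
  "lacunary_cube m \<equiv> dyadic_cube (int m + 1) (1)"

lemma lacunary_cube_disjoint:
  assumes "m \<noteq> m'"
  shows "(lacunary_cube m :: (real ^ 'n) set) \<inter> lacunary_cube m' = {}"
proof -
  have *: "(lacunary_cube m :: (real ^ 'n) set) \<inter> lacunary_cube m' = {}" if less: "m < m'" for m m'
  proof (rule ccontr)
    assume "\<not> ?thesis"
    then obtain x :: "real ^ 'n" where x: "x \<in> lacunary_cube m" "x \<in> lacunary_cube m'" by blast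
    fix i :: 'n
    have "2 powr (real m' + 1) \<le> x $ i" "x $ i < 2 * 2 powr (real m + 1)"
      using x by (auto simp: mem_dyadic_cube)
    moreover have "2 * 2 powr (real m + 1) = (2::real) powr (real m + 2)"
      by (simp add: powr_add)
    moreover have "(2::real) powr (real m + 2) \<le> 2 powr (real m' + 1)"
      using less by simp
    ultimately show False by linarith
  qed
  show ?thesis using *[of m m'] *[of m' m] assms by (cases "m < m'") auto
qed

lemma lacunary_bumps_on_cube:
  assumes "x \<in> lacunary_cube m"
  shows "lacunary_bumps p (x :: real ^ 'n) =
    2 powr (- real m * real CARD('n) / p) * indicator (lacunary_bump m) x"
proof -
  have "x \<notin> lacunary_bump l" if "l \<noteq> m" for l
    using lacunary_cube_disjoint[OF that] dyadic_child_subset[of "int l + 1" 1] assms by blast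
  then have "lacunary_bumps p x =
      (\<Sum>l\<in>{m}. 2 powr (- real l * real CARD('n) / p) * indicator (lacunary_bump l) x)"
    unfolding lacunary_bumps_def by (intro suminf_finite) auto
  then show ?thesis
    by (simp only: sum.insert sum.empty finite.emptyI empty_iff not_False_eq_True add_0_right)
qed

text \<open>All coordinates of a point in bump m are at least 2^(m+1), so one small coordinate
  already excludes every bump from \<open>M\<close> on.\<close>

lemma lacunary_bumps_eq_sum:
  assumes "x $ i < 2 powr (real M + 1)"
  shows "lacunary_bumps p (x :: real ^ 'n) =
    (\<Sum>m<M. 2 powr (- real m * real CARD('n) / p) * indicator (lacunary_bump m) x)"
proof -
  have "x \<notin> lacunary_bump m" if "m \<ge> M" for m
  proof
    assume "x \<in> lacunary_bump m"
    then have "2 powr (real m + 1) \<le> x $ i"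
      using dyadic_child_subset[of "int m + 1" 1] by (force simp: mem_dyadic_cube)
    moreover have "(2::real) powr (real M + 1) \<le> 2 powr (real m + 1)"
      using that by simp
    ultimately show False using assms by linarith
  qed
  then show ?thesis
    unfolding lacunary_bumps_def by (subst suminf_finite[of "{..<M}"]) auto
qed

lemma integrable_indicator_lmeasurable:
  "A \<in> lmeasurable \<Longrightarrow> integrable lebesgue (indicator A :: _ \<Rightarrow> real)"
  unfolding fmeasurable_def by (auto intro!: integrable_real_indicator)

lemma integrable_sum_dyadic_cubes:
  assumes "\<And>i. i \<in> I \<Longrightarrow> R i \<in> dyadic_cubes"
  shows "integrable lebesgue (\<lambda>x. \<Sum>i\<in>I. (c i :: real) * indicator (R i) x)"
  by (intro Bochner_Integration.integrable_sum integrable_mult_right integrable_indicator_lmeasurable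
      dyadic_cubes_lmeasurable assms)

lemma dyadic_child_in_dyadic_cubes: "dyadic_child k j \<in> dyadic_cubes"
  by (simp add: dyadic_child_def dyadic_cube_in_dyadic_cubes)

lemma integrable_imp_set_integrable:
  "integrable lebesgue (f :: _ \<Rightarrow> real) \<Longrightarrow> A \<in> sets lebesgue \<Longrightarrow> set_integrable lebesgue A f"
  unfolding set_integrable_def by (rule integrable_mult_indicator)

lemma lacunary_bumps_L1_loc: "lacunary_bumps p \<in> (L1_loc :: (real ^ 'n \<Rightarrow> real) set)"
  unfolding L1_loc_def
proof (intro CollectI allI impI)
  fix K :: "(real ^ 'n) set" assume K: "compact K"
  then obtain B where B: "\<And>x. x \<in> K \<Longrightarrow> norm x \<le> B"
    using compact_imp_bounded bounded_iff by metis
  \<comment> \<open>A compact set meets only finitely many bumps. The crude bound M < 2^M converts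
    its radius into a scale.\<close>
  obtain M where M: "B < real M" using reals_Archimedean2 by blast
  have *: "x $ i < 2 powr (real M + 1)" if "x \<in> K" for x i
  proof -
    have "x $ i \<le> B" using component_le_norm_cart[of x i] B[OF that] by linarith
    also have "B < real M" by (rule M)
    also have "real M < 2 ^ M" by (rule of_nat_less_two_power)
    also have "(2::real) ^ M \<le> 2 powr (real M + 1)" by (simp add: powr_add powr_realpow)
    finally show ?thesis .
  qed
  have "set_integrable lebesgue K (\<lambda>x. \<Sum>m<M. 2 powr (- real m * real CARD('n) / p) * indicator (lacunary_bump m) x)"
    using compact_imp_closed[OF K]
    by (intro integrable_imp_set_integrable integrable_sum_dyadic_cubes dyadic_child_in_dyadic_cubes) auto
  then show "lacunary_bumps p absolutely_integrable_on K"
    using * by (subst set_integrable_cong[OF refl refl lacunary_bumps_eq_sum]) auto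
qed

lemma JN_norm_lacunary_bumps:
  assumes "p > 0"
  shows "JN_norm p (lacunary_bumps p :: real ^ 'n \<Rightarrow> real) = \<infinity>"
proof (rule ccontr)
  let ?f = "lacunary_bumps p :: real ^ 'n \<Rightarrow> real"
  assume "\<not> ?thesis"
  then have "JN_norm p ?f < \<infinity>" by (simp add: less_top)
  then obtain S where S: "\<And>F :: (real ^ 'n) set set. finite F \<Longrightarrow> F \<subseteq> dyadic_cubes \<Longrightarrow> disjoint F \<Longrightarrow>
    (\<Sum>Q\<in>F. measure lebesgue Q * mean_osc ?f Q powr p) \<le> S"
    using JN_norm_finiteE by blast
  obtain \<kappa> where \<kappa>: "\<kappa> > 0" "\<And>(f :: real ^ 'n \<Rightarrow> real) a b k j.
       (\<And>x. x \<in> dyadic_cube k j \<Longrightarrow> f x = b + a * indicator (dyadic_child k j) x) \<Longrightarrow>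
       mean_osc f (dyadic_cube k j) = \<bar>a\<bar> * \<kappa>"
    using mean_osc_child by blast
  \<comment> \<open>The bump weights are normalised to the scale 2^m of the child. The parent has
    sidelength 2^(m+1), which leaves the factor 2^n in its contribution.\<close>
  define d where "d = 2 powr real CARD('n) * \<kappa> powr p"
  have d: "d > 0" using \<kappa>(1) by (simp add: d_def)
  have eq: "measure lebesgue (lacunary_cube m :: (real ^ 'n) set) * mean_osc ?f (lacunary_cube m) powr p = d" for m
  proof -
    have "mean_osc ?f (lacunary_cube m) = 2 powr (- real m * real CARD('n) / p) * \<kappa>"
      using \<kappa>(2)[of "int m + 1" 1 ?f 0 "2 powr (- real m * real CARD('n) / p)"]
      by (simp add: lacunary_bumps_on_cube)
    then have "mean_osc ?f (lacunary_cube m) powr p = 2 powr (- real m * real CARD('n)) * \<kappa> powr p"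
      using assms \<kappa>(1) by (simp add: powr_mult powr_powr)
    then show ?thesis
      by (simp add: measure_dyadic_cube d_def algebra_simps flip: powr_add)
  qed
  have inj: "inj (lacunary_cube :: nat \<Rightarrow> (real ^ 'n) set)"
    by (auto simp: inj_on_def dyadic_cube_inject)
  have "real N * d \<le> S" for N
  proof -
    have disj: "disjoint (lacunary_cube ` {..<N} :: (real ^ 'n) set set)"
    proof (rule disjointI)
      fix A B :: "(real ^ 'n) set"
      assume "A \<in> lacunary_cube ` {..<N}" "B \<in> lacunary_cube ` {..<N}" "A \<noteq> B"
      then obtain m m' where "A = lacunary_cube m" "B = lacunary_cube m'" by blast
      with \<open>A \<noteq> B\<close> show "A \<inter> B = {}" using lacunary_cube_disjoint[of m m'] by auto
    qed
    have "(\<Sum>Q\<in>lacunary_cube ` {..<N}. measure lebesgue Q * mean_osc ?f Q powr p) \<le> S"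
      by (rule S) (use disj in \<open>auto simp: dyadic_cube_in_dyadic_cubes\<close>)
    then show ?thesis
      by (simp add: sum.reindex[OF inj_on_subset[OF inj]] eq)
  qed
  moreover obtain N where "S / d < real N" using reals_Archimedean2 by blast
  ultimately show False using d by (simp add: field_simps not_less[symmetric])
qed

text \<open>A cube that meets a bump without lying inside it has a larger level than the bump. One
  level up it is the parent \<open>lacunary_cube m\<close>; from two levels up it contains a point
  of [0, 2^(m+2))^n and is the cube at the origin of its level.\<close>

lemma mean_osc_lacunary_bumps_nonzero:
  fixes j :: "int ^ 'n"
  assumes "mean_osc (lacunary_bumps p) (dyadic_cube k j) \<noteq> 0"
  shows "k \<ge> 1 \<and> j \<in> {0, 1}"
proof -
  let ?Q = "dyadic_cube k j"
  have const: "mean_osc (lacunary_bumps p) ?Q = 0" if "\<And>x. x \<in> ?Q \<Longrightarrow> lacunary_bumps p x = c" for c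
    by (rule mean_osc_const) (use that in \<open>auto simp: lmeasurable_dyadic_cube measure_dyadic_cube\<close>)
  obtain m x where x: "x \<in> ?Q" "x \<in> lacunary_bump m"
  proof (cases "\<exists>m. ?Q \<inter> lacunary_bump m \<noteq> {}")
    case False
    then have "lacunary_bumps p x = 0" if "x \<in> ?Q" for x
      using that unfolding lacunary_bumps_def by (subst suminf_finite[of "{}"]) (auto simp: indicator_def)
    with const assms show ?thesis by blast
  qed (use that in blast)
  have "\<not> ?Q \<subseteq> lacunary_bump m"
  proof
    assume sub: "?Q \<subseteq> lacunary_bump m"
    have "lacunary_bumps p x = 2 powr (- real m * real CARD('n) / p)" if "x \<in> ?Q" for x
    proof -
      have "x \<in> lacunary_bump m" using sub that by blast
      moreover from this have "x \<in> lacunary_cube m" using dyadic_child_subset by blast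
      ultimately show ?thesis by (simp add: lacunary_bumps_on_cube)
    qed
    with const assms show False by blast
  qed
  then have km: "k \<ge> int m + 1"
    using dyadic_cube_subset_of_meet[of k "int m" x j "\<chi> i. 2 * 1 $ i"] x
    by (force simp: dyadic_child_def)
  have xm: "x \<in> lacunary_cube m" using x(2) dyadic_child_subset by blast
  show ?thesis
  proof (cases "k = int m + 1")
    case True
    then have "?Q \<subseteq> lacunary_cube m" "lacunary_cube m \<subseteq> ?Q"
      using dyadic_cube_subset_of_meet[OF _ x(1) xm] dyadic_cube_subset_of_meet[OF _ xm x(1)] by auto
    then have "?Q = lacunary_cube m" by blast
    then show ?thesis by (auto simp: dyadic_cube_inject)
  next
    case False
    with km have k: "k \<ge> int m + 2" by simp
    have "x \<in> dyadic_cube k (0)"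
      unfolding mem_dyadic_cube
    proof
      fix i
      have "2 powr (real m + 1) \<le> x $ i" "x $ i < 2 * 2 powr (real m + 1)"
        using xm by (auto simp: mem_dyadic_cube)
      moreover have "2 * 2 powr (real m + 1) = (2::real) powr (real m + 2)"
        by (simp add: powr_add)
      moreover have "real m + 2 \<le> real_of_int k"
        using k by linarith
      then have "(2::real) powr (real m + 2) \<le> 2 powr real_of_int k" by simp
      moreover have "(2::real) powr (real m + 1) > 0" by simp
      ultimately have "0 \<le> x $ i" "x $ i < 2 powr real_of_int k" by linarith+
      then show "real_of_int (0 $ i) * 2 powr real_of_int k \<le> x $ i \<and>
          x $ i < (real_of_int (0 $ i) + 1) * 2 powr real_of_int k" by simp
    qed
    then have "?Q = dyadic_cube k (0)"
      using dyadic_cube_subset_of_meet[of k k x] x(1) by blast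
    then show ?thesis using k by (auto simp: dyadic_cube_inject)
  qed
qed

lemma mean_osc_lacunary_bumps_le:
  assumes "p > 1"
  obtains D where "D > 0"
    "\<And>k (j :: int ^ 'n). k \<ge> 1 \<Longrightarrow> j \<in> {0, 1} \<Longrightarrow>
      mean_osc (lacunary_bumps p) (dyadic_cube k j) \<le> D * 2 powr (- real_of_int k * real CARD('n) / p)"
proof -
  \<comment> \<open>Bump m has height 2^(-mn/p) and measure 2^(mn), hence mass 2^(ms). That
    \<open>s\<close> is positive is where \<open>p > 1\<close> enters: the last bump then dominates
    all the smaller ones.\<close>
  define s where "s = real CARD('n) * (1 - 1 / p)"
  have s: "s > 0" using assms by (simp add: s_def)
  obtain C where C: "C > 0"
    "\<And>(F::int set) T. finite F \<Longrightarrow> T \<ge> 0 \<Longrightarrow> (\<And>k. k \<in> F \<Longrightarrow> 2 powr (real_of_int k * s) \<le> T) \<Longrightarrow>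
       (\<Sum>k\<in>F. 2 powr (real_of_int k * s)) \<le> C * T"
    using geometric_sum_le[of s] s by auto
  show ?thesis
  proof (rule that)
    show "2 * C > 0" using C by simp
    fix k :: int and j :: "int ^ 'n" assume k: "k \<ge> 1" and j: "j \<in> {0, 1}"
    \<comment> \<open>Both candidate cubes have upper endpoints at most 2^(K+1), so only bumps below
      \<open>K\<close> can meet them. For \<open>j = 1\<close> the cube is
      \<open>lacunary_cube (K - 1)\<close>, whose own bump is the last one in the sum.\<close>
    define K where "K = nat k"
    have K: "real_of_int k = real K" using k by (simp add: K_def)
    let ?Q = "dyadic_cube k j"
    define g :: "real ^ 'n \<Rightarrow> real" where
      "g x = (\<Sum>m<K. 2 powr (- real m * real CARD('n) / p) * indicator (lacunary_bump m) x)" for x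
    have "lacunary_bumps p x = g x" if "x \<in> ?Q" for x
    proof -
      fix i :: 'n
      have "x $ i < (real_of_int (j $ i) + 1) * 2 powr real K"
        using that by (simp add: mem_dyadic_cube K)
      also have "\<dots> \<le> 2 * 2 powr real K"
        using j by (intro mult_right_mono) auto
      also have "\<dots> = 2 powr (real K + 1)" by (simp add: powr_add)
      finally show ?thesis unfolding g_def by (rule lacunary_bumps_eq_sum)
    qed
    then have "mean_osc (lacunary_bumps p) ?Q = mean_osc g ?Q" by (rule mean_osc_cong)
    also have "\<dots> \<le> 2 / measure lebesgue ?Q * (LINT x:?Q|lebesgue. \<bar>g x\<bar>)"
    proof (rule mean_osc_le)
      show "set_integrable lebesgue ?Q g"
        using lmeasurable_dyadic_cube[of k j] unfolding g_def
        by (intro integrable_imp_set_integrable integrable_sum_dyadic_cubes dyadic_child_in_dyadic_cubes)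
          (auto simp: fmeasurable_def)
    qed (auto simp: lmeasurable_dyadic_cube measure_dyadic_cube)
    also have "\<dots> \<le> 2 / measure lebesgue ?Q * (C * 2 powr (real K * s))"
    proof (intro mult_left_mono)
      have g: "integrable lebesgue g"
        unfolding g_def by (intro integrable_sum_dyadic_cubes dyadic_child_in_dyadic_cubes)
      have g0: "g x \<ge> 0" for x unfolding g_def by (intro sum_nonneg) auto
      have "(LINT x:?Q|lebesgue. \<bar>g x\<bar>) \<le> (LINT x|lebesgue. g x)"
        unfolding set_lebesgue_integral_def
        using g g0 lmeasurable_dyadic_cube[of k j]
        by (intro integral_mono integrable_mult_indicator integrable_abs)
          (auto simp: fmeasurable_def indicator_def)
      also have "\<dots> = (\<Sum>m<K. 2 powr (- real m * real CARD('n) / p) * measure lebesgue (lacunary_bump m :: (real ^ 'n) set))"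
        unfolding g_def
        by (subst Bochner_Integration.integral_sum)
          (auto intro!: integrable_mult_right integrable_indicator_lmeasurable
            dyadic_cubes_lmeasurable dyadic_child_in_dyadic_cubes)
      also have "\<dots> = (\<Sum>m<K. 2 powr (real m * s))"
        by (intro sum.cong) (auto simp: dyadic_child_def measure_dyadic_cube s_def right_diff_distrib simp flip: powr_add)
      also have "\<dots> = (\<Sum>m\<in>int ` {..<K}. 2 powr (real_of_int m * s))"
        by (simp add: sum.reindex)
      also have "\<dots> \<le> C * 2 powr (real K * s)"
        using s by (intro C(2)) auto
      finally show "(LINT x:?Q|lebesgue. \<bar>g x\<bar>) \<le> C * 2 powr (real K * s)" .
    qed simp
    also have "\<dots> = 2 * C * (2 powr (real K * s) / 2 powr (real K * real CARD('n)))"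
      by (simp add: measure_dyadic_cube K)
    also have "2 powr (real K * s) / 2 powr (real K * real CARD('n)) = 2 powr (- real_of_int k * real CARD('n) / p)"
      by (simp add: K s_def algebra_simps flip: powr_diff)
    finally show "mean_osc (lacunary_bumps p) ?Q \<le> 2 * C * 2 powr (- real_of_int k * real CARD('n) / p)" .
  qed
qed

text \<open>On an oscillating cube, b(f)_Q is at most \<open>D\<close> times its weight to the power
  -1/p. Exceeding t therefore caps the weight at (D/t)^p, and with at most two such cubes per level
  the total weight is comparable to this cap. Multiplication by t^p removes t.\<close>

lemma weak_seq_norm_lacunary_bumps:
  assumes "p > 1" "\<gamma> \<noteq> real CARD('n)"
  shows "weak_seq_norm p \<gamma> (osc_seq p \<gamma> (lacunary_bumps p :: real ^ 'n \<Rightarrow> real)) < \<infinity>"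
proof -
  let ?f = "lacunary_bumps p :: real ^ 'n \<Rightarrow> real"
  define s where "s = real CARD('n) - \<gamma>"
  obtain C where C: "C > 0"
    "\<And>(F::int set) T. finite F \<Longrightarrow> T \<ge> 0 \<Longrightarrow> (\<And>k. k \<in> F \<Longrightarrow> 2 powr (real_of_int k * s) \<le> T) \<Longrightarrow>
       (\<Sum>k\<in>F. 2 powr (real_of_int k * s)) \<le> C * T"
    using geometric_sum_le[of s] assms(2) by (auto simp: s_def)
  obtain D where D: "D > 0"
    "\<And>k (j :: int ^ 'n). k \<ge> 1 \<Longrightarrow> j \<in> {0, 1} \<Longrightarrow>
      mean_osc ?f (dyadic_cube k j) \<le> D * 2 powr (- real_of_int k * real CARD('n) / p)"
    using mean_osc_lacunary_bumps_le[OF assms(1)] by blast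
  show ?thesis
  proof (rule weak_seq_norm_finiteI)
    fix t :: real and F :: "(real ^ 'n) set set"
    assume t: "t > 0" and F: "finite F" "F \<subseteq> {Q \<in> dyadic_cubes. \<bar>osc_seq p \<gamma> ?f Q\<bar> > t}"
    have Fd: "Q \<in> dyadic_cubes" if "Q \<in> F" for Q using that F(2) by blast
    define L where "L = dyadic_level ` F"
    have key: "2 powr (real_of_int k * s) \<le> (D / t) powr p \<and> j \<in> {0, 1}" if "dyadic_cube k j \<in> F" for k j
    proof -
      have gt: "t < 2 powr (real_of_int k * \<gamma> / p) * mean_osc ?f (dyadic_cube k j)"
        using that F(2) by (auto simp: osc_seq_def mean_osc_nonneg sidelength_dyadic_cube powi_two_eq_powr powr_powr)
      then have "mean_osc ?f (dyadic_cube k j) \<noteq> 0" using t by auto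
      from mean_osc_lacunary_bumps_nonzero[OF this] have kj: "k \<ge> 1" "j \<in> {0, 1}" by auto
      have "2 powr (real_of_int k * \<gamma> / p) * mean_osc ?f (dyadic_cube k j) \<le>
          2 powr (real_of_int k * \<gamma> / p) * (D * 2 powr (- real_of_int k * real CARD('n) / p))"
        using D(2)[OF kj] by (intro mult_left_mono) auto
      also have "\<dots> = D * 2 powr (- (real_of_int k * s) / p)"
        by (simp add: s_def algebra_simps diff_divide_distrib flip: powr_add)
      finally have "t < D * 2 powr (- (real_of_int k * s) / p)" using gt by linarith
      then have "2 powr (real_of_int k * s / p) \<le> D / t"
        using t by (simp add: powr_minus field_simps)
      then have "(2 powr (real_of_int k * s / p)) powr p \<le> (D / t) powr p"
        using assms(1) by (intro powr_mono2) auto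
      then show ?thesis using kj(2) assms(1) by (simp add: powr_powr)
    qed
    let ?cube = "\<lambda>(j, k). dyadic_cube k j :: (real ^ 'n) set"
    have sub: "F \<subseteq> ?cube ` ({0, 1} \<times> L)"
    proof
      fix Q assume Q: "Q \<in> F"
      then obtain k j where "Q = dyadic_cube k j" using Fd[OF Q] by (auto simp: dyadic_cubes_def)
      with key[of k j] Q show "Q \<in> ?cube ` ({0, 1} \<times> L)"
        by (force simp: L_def)
    qed
    have fin: "finite ({0, 1 :: int ^ 'n} \<times> L)" using F(1) by (simp add: L_def)
    have ne: "0 \<noteq> (1 :: int ^ 'n)" by (simp add: vec_eq_iff)
    have "(\<Sum>Q\<in>F. dyadic_weight \<gamma> Q) \<le> (\<Sum>Q\<in>?cube ` ({0, 1} \<times> L). dyadic_weight \<gamma> Q)"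
      using sub fin by (intro sum_mono2) (auto simp: dyadic_weight_nonneg)
    also have "\<dots> \<le> (\<Sum>x\<in>{0, 1} \<times> L. dyadic_weight \<gamma> (?cube x))"
      using sum_image_le[OF fin, of "dyadic_weight \<gamma>" ?cube] by (simp add: dyadic_weight_nonneg o_def)
    also have "\<dots> = (\<Sum>x\<in>{0, 1 :: int ^ 'n} \<times> L. 2 powr (real_of_int (snd x) * s))"
      by (intro sum.cong refl) (auto simp: dyadic_weight_eq dyadic_cube_in_dyadic_cubes s_def)
    also have "\<dots> = 2 * (\<Sum>k\<in>L. 2 powr (real_of_int k * s))"
      using ne by (simp add: sum.cartesian_product' case_prod_beta)
    also have "\<dots> \<le> 2 * (C * (D / t) powr p)"
    proof (intro mult_left_mono C(2))
      fix k assume "k \<in> L"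
      then obtain Q where Q: "Q \<in> F" "k = dyadic_level Q" by (auto simp: L_def)
      then obtain k' j where Q': "Q = dyadic_cube k' j" using Fd[OF Q(1)] by (auto simp: dyadic_cubes_def)
      then have "k = k'" using Q(2) by simp
      then show "2 powr (real_of_int k * s) \<le> (D / t) powr p" using key[of k' j] Q(1) Q' by simp
    qed (use F(1) in \<open>auto simp: L_def\<close>)
    finally have "t powr p * (\<Sum>Q\<in>F. dyadic_weight \<gamma> Q) \<le> t powr p * (2 * (C * (D / t) powr p))"
      by (intro mult_left_mono) auto
    also have "\<dots> = 2 * C * D powr p"
      using t D(1) by (simp add: powr_divide)
    finally show "t powr p * (\<Sum>Q\<in>F. sidelength Q powr (- \<gamma>) * measure lebesgue Q) \<le> 2 * C * D powr p"
      by (simp add: dyadic_weight_def)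
  qed
qed

section \<open>The weak $L^p$ norm and rearrangements\<close>

lemma sum_disjoint_bumps:
  fixes I :: "'a set" and s J :: "'a \<Rightarrow> int" and c :: "'a \<Rightarrow> real" and x :: "real ^ 'n"
  assumes I: "finite I" and disj: "\<forall>a\<in>I. \<forall>b\<in>I. a \<noteq> b \<longrightarrow>
      dyadic_cube (s a) (vec (J a)) \<inter> (dyadic_cube (s b) (vec (J b)) :: (real ^ 'n) set) = {}"
    and b: "b \<in> I" "x \<in> dyadic_cube (s b) (vec (J b))"
  shows "(\<Sum>a\<in>I. c a * indicator (dyadic_child (s a) (vec (J a))) x) =
    c b * indicator (dyadic_child (s b) (vec (J b))) x"
proof -
  have "x \<notin> dyadic_child (s a) (vec (J a))" if "a \<in> I - {b}" for a
    using disj that b dyadic_child_subset[of "s a" "vec (J a)"] by blast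
  then have "(\<Sum>a\<in>I - {b}. c a * indicator (dyadic_child (s a) (vec (J a))) x) = 0"
    by (intro sum.neutral) auto
  then show ?thesis
    using sum.remove[OF I b(1), of "\<lambda>a. c a * indicator (dyadic_child (s a) (vec (J a))) x"] by simp
qed

lemma sum_Sigma_fst:
  fixes X :: "'a \<Rightarrow> real"
  assumes "finite M"
  shows "(\<Sum>a\<in>Sigma M (\<lambda>m. {..<N m :: nat}). X (fst a)) = (\<Sum>m\<in>M. real (N m) * X m)"
proof -
  have "(\<Sum>m\<in>M. \<Sum>i\<in>{..<N m}. X m) = (\<Sum>(m, i)\<in>Sigma M (\<lambda>m. {..<N m}). X m)"
    using assms by (intro sum.Sigma) auto
  then show ?thesis by (simp add: case_prod_beta)
qed

lemma integrable_imp_L1_loc: "integrable lebesgue f \<Longrightarrow> f \<in> L1_loc"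
  by (auto simp: L1_loc_def compact_imp_closed intro!: integrable_imp_set_integrable)

text \<open>The weights $2^{-k\gamma/p}$ give all bumps the same value of $b(f)_Q$. With about
  $2^{k(\gamma-n)}$ bumps of scale $2^k$, every scale contributes a constant to the weak sequence
  norm, while the measures of the scales form the geometric progression $2^{k\gamma}$, which keeps
  the weak $L^p$ norm bounded.\<close>

lemma weak_seq_norm_unbounded_over_weak_Lp:
  assumes p: "p > 1" and \<gamma>: "\<gamma> \<notin> {0..real CARD('n)}"
  obtains c B where "c > 0" "B > 0"
    "\<And>K :: nat. \<exists>f :: real ^ 'n \<Rightarrow> real. f \<in> L1_loc \<and> weak_Lp_norm p f \<le> ennreal (B powr (1 / p)) \<and>
       ennreal ((c * real K) powr (1 / p)) \<le> weak_seq_norm p \<gamma> (osc_seq p \<gamma> f)"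
proof -
  obtain \<kappa> where \<kappa>: "\<kappa> > 0" "\<And>(f :: real ^ 'n \<Rightarrow> real) a b k j.
       (\<And>x. x \<in> dyadic_cube k j \<Longrightarrow> f x = b + a * indicator (dyadic_child k j) x) \<Longrightarrow>
       mean_osc f (dyadic_cube k j) = \<bar>a\<bar> * \<kappa>"
    using mean_osc_child by blast
  have \<gamma>0: "\<gamma> \<noteq> 0" using \<gamma> by auto
  obtain C where C: "C > 0"
    "\<And>(F::int set) T. finite F \<Longrightarrow> T \<ge> 0 \<Longrightarrow> (\<And>k. k \<in> F \<Longrightarrow> 2 powr (real_of_int k * \<gamma>) \<le> T) \<Longrightarrow>
       (\<Sum>k\<in>F. 2 powr (real_of_int k * \<gamma>)) \<le> C * T"
    using geometric_sum_le[OF \<gamma>0] by auto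
  \<comment> \<open>The sign makes the exponent k(\<gamma> - n) nonnegative in both cases. The
    prescribed number of bumps is then at least 1, so rounding it up at most doubles it.\<close>
  define e :: int where "e = (if \<gamma> > 0 then 1 else -1)"
  define k :: "nat \<Rightarrow> int" where "k m = e * int m" for m
  have inj_k: "inj k" by (auto simp: inj_def k_def e_def)
  define N :: "nat \<Rightarrow> nat" where "N m = nat \<lceil>2 powr (real_of_int (k m) * (\<gamma> - real CARD('n)))\<rceil>" for m
  have N: "2 powr (real_of_int (k m) * (\<gamma> - real CARD('n))) \<le> real (N m)"
    "real (N m) \<le> 2 * 2 powr (real_of_int (k m) * (\<gamma> - real CARD('n)))" for m
  proof -
    have "real_of_int (k m) * (\<gamma> - real CARD('n)) \<ge> 0"
      using \<gamma> by (auto simp: k_def e_def mult_nonneg_nonneg mult_nonneg_nonpos zero_le_mult_iff)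
    then have "2 powr (real_of_int (k m) * (\<gamma> - real CARD('n))) \<ge> 1"
      by (simp add: ge_one_powr_ge_zero)
    then show "2 powr (real_of_int (k m) * (\<gamma> - real CARD('n))) \<le> real (N m)"
      "real (N m) \<le> 2 * 2 powr (real_of_int (k m) * (\<gamma> - real CARD('n)))"
      unfolding N_def by linarith+
  qed
  show ?thesis
  proof (rule that)
    \<comment> \<open>The level \<kappa>/2 lies strictly below the common value \<kappa> of b(f) on
      all chosen cubes. In the other constant, 2 comes from rounding and \<open>C\<close> from the
      geometric sum of the measures.\<close>
    show "(\<kappa> / 2) powr p > 0" "2 * C > 0" using \<kappa> C by auto
    fix K :: nat
    define I where "I = Sigma {..<K} (\<lambda>m. {..<N m})"
    have I: "finite I" by (simp add: I_def)
    define s :: "nat \<times> nat \<Rightarrow> int" where "s a = k (fst a)" for a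
    obtain J where J: "\<forall>a\<in>I. \<forall>b\<in>I. a \<noteq> b \<longrightarrow>
      dyadic_cube (s a) (vec (J a)) \<inter> (dyadic_cube (s b) (vec (J b)) :: (real ^ 'n) set) = {}"
      using exists_disjoint_dyadic_cubes[OF I, of s] by blast
    define Q :: "nat \<times> nat \<Rightarrow> (real ^ 'n) set" where "Q a = dyadic_cube (s a) (vec (J a))" for a
    define R :: "nat \<times> nat \<Rightarrow> (real ^ 'n) set" where "R a = dyadic_child (s a) (vec (J a))" for a
    define w where "w a = 2 powr (- (real_of_int (s a) * \<gamma> / p))" for a
    define f :: "real ^ 'n \<Rightarrow> real" where "f x = (\<Sum>a\<in>I. w a * indicator (R a) x)" for x
    have RQ: "R a \<subseteq> Q a" for a unfolding R_def Q_def by (rule dyadic_child_subset)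
    have R_cube: "R a \<in> dyadic_cubes" for a by (simp add: R_def dyadic_child_in_dyadic_cubes)
    have Q_cube: "Q a \<in> dyadic_cubes" for a by (simp add: Q_def dyadic_cube_in_dyadic_cubes)
    have fQ: "f x = w b * indicator (R b) x" if "b \<in> I" "x \<in> Q b" for x b
      using sum_disjoint_bumps[OF I J, of b x w] that by (simp add: f_def R_def Q_def)
    have "f \<in> L1_loc"
      unfolding f_def by (intro integrable_imp_L1_loc integrable_sum_dyadic_cubes R_cube)
    moreover have "weak_Lp_norm p f \<le> ennreal ((2 * C) powr (1 / p))"
    proof (rule weak_Lp_norm_le)
      fix t :: real assume t: "t > 0"
      \<comment> \<open>The scales whose bumps are higher than t. Raised to the power
        \<open>p\<close>, this condition reads 2^(k\<gamma>) < t^(-p), which is the bound on the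
        terms that the geometric sum requires.\<close>
      define M where "M = {m \<in> {..<K}. 2 powr (- (real_of_int (k m) * \<gamma> / p)) > t}"
      have M: "finite M" by (simp add: M_def)
      let ?I = "Sigma M (\<lambda>m. {..<N m})"
      have sub: "{x. \<bar>f x\<bar> > t} \<subseteq> (\<Union>a\<in>?I. R a)"
      proof
        fix x assume "x \<in> {x. \<bar>f x\<bar> > t}"
        then have x: "\<bar>f x\<bar> > t" by simp
        then have "f x \<noteq> 0" using t by auto
        then obtain a where a: "a \<in> I" "x \<in> R a"
          unfolding f_def by (metis (no_types, lifting) indicator_simps(2) mult_zero_right sum.neutral)
        then have "f x = w a" using fQ[of a x] RQ[of a] by auto
        then have "w a > t" using x by (simp add: w_def)
        then have "a \<in> ?I" using a(1) by (auto simp: I_def M_def w_def s_def)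
        with a(2) show "x \<in> (\<Union>a\<in>?I. R a)" by blast
      qed
      have R_meas: "R a \<in> lmeasurable" for a using R_cube by (rule dyadic_cubes_lmeasurable)
      then have R_sets: "R a \<in> sets lebesgue" for a by (auto simp: fmeasurable_def)
      have "emeasure lebesgue {x. \<bar>f x\<bar> > t} \<le> emeasure lebesgue (\<Union>a\<in>?I. R a)"
        using M R_sets by (intro emeasure_mono sub sets.finite_UN) auto
      also have "\<dots> \<le> (\<Sum>a\<in>?I. emeasure lebesgue (R a))"
        using M R_sets by (intro emeasure_subadditive_finite) auto
      also have "\<dots> = (\<Sum>a\<in>?I. ennreal (measure lebesgue (R a)))"
        using R_meas by (simp add: emeasure_eq_measure2)
      also have "\<dots> = ennreal (\<Sum>a\<in>?I. measure lebesgue (R a))"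
        by (intro sum_ennreal) auto
      also have "\<dots> \<le> ennreal (2 * C / t powr p)"
      proof (rule ennreal_leI)
        have "(\<Sum>a\<in>?I. measure lebesgue (R a)) \<le> (\<Sum>a\<in>?I. 2 powr (real_of_int (k (fst a)) * real CARD('n)))"
          by (intro sum_mono) (auto simp: R_def dyadic_child_def measure_dyadic_cube s_def mult_right_mono)
        also have "\<dots> = (\<Sum>m\<in>M. real (N m) * 2 powr (real_of_int (k m) * real CARD('n)))"
          by (rule sum_Sigma_fst[OF M])
        also have "\<dots> \<le> (\<Sum>m\<in>M. 2 * 2 powr (real_of_int (k m) * \<gamma>))"
        proof (rule sum_mono)
          fix m
          have "real (N m) * 2 powr (real_of_int (k m) * real CARD('n)) \<le>
              (2 * 2 powr (real_of_int (k m) * (\<gamma> - real CARD('n)))) * 2 powr (real_of_int (k m) * real CARD('n))"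
            by (intro mult_right_mono N) auto
          also have "\<dots> = 2 * 2 powr (real_of_int (k m) * \<gamma>)"
            by (simp add: algebra_simps flip: powr_add)
          finally show "real (N m) * 2 powr (real_of_int (k m) * real CARD('n)) \<le> 2 * 2 powr (real_of_int (k m) * \<gamma>)" .
        qed
        also have "\<dots> = 2 * (\<Sum>i\<in>k ` M. 2 powr (real_of_int i * \<gamma>))"
          by (simp add: sum.reindex[OF inj_on_subset[OF inj_k]] sum_distrib_left)
        also have "\<dots> \<le> 2 * (C * (1 / t powr p))"
        proof (intro mult_left_mono C(2))
          fix i assume "i \<in> k ` M"
          then have "t \<le> 2 powr (- (real_of_int i * \<gamma> / p))" by (auto simp: M_def)
          then have "t powr p \<le> (2 powr (- (real_of_int i * \<gamma> / p))) powr p"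
            using t p by (intro powr_mono2) auto
          also have "\<dots> = 1 / 2 powr (real_of_int i * \<gamma>)"
            using p by (simp add: powr_powr flip: powr_minus_divide)
          finally show "2 powr (real_of_int i * \<gamma>) \<le> 1 / t powr p"
            using t by (simp add: field_simps)
        qed (use M in auto)
        finally show "(\<Sum>a\<in>?I. measure lebesgue (R a)) \<le> 2 * C / t powr p" by simp
      qed
      finally show "emeasure lebesgue {x. \<bar>f x\<bar> > t} \<le> ennreal (2 * C / t powr p)" .
    qed (use p C in auto)
    moreover have "ennreal (((\<kappa> / 2) powr p * real K) powr (1 / p)) \<le> weak_seq_norm p \<gamma> (osc_seq p \<gamma> f)"
    proof -
      have osc: "osc_seq p \<gamma> f (Q b) = \<kappa>" if "b \<in> I" for b
      proof -
        have "mean_osc f (Q b) = \<bar>w b\<bar> * \<kappa>"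
          using \<kappa>(2)[of "s b" "vec (J b)" f 0 "w b"] fQ[OF that] by (simp add: Q_def R_def)
        then show ?thesis
          by (simp add: osc_seq_def w_def Q_def sidelength_dyadic_cube powi_two_eq_powr powr_powr powr_minus_divide)
      qed
      have inj: "inj_on Q I"
      proof (rule inj_onI, rule ccontr)
        fix a b assume "a \<in> I" "b \<in> I" "Q a = Q b" "a \<noteq> b"
        with J have "Q a = {}" by (auto simp: Q_def)
        then show False by (simp add: Q_def dyadic_cube_nonempty)
      qed
      \<comment> \<open>Since \<open>N m\<close> was rounded up, each of the \<open>K\<close> scales
        has total weight at least 1.\<close>
      have "real K = (\<Sum>m<K. 1)" by simp
      also have "\<dots> \<le> (\<Sum>m<K. real (N m) * 2 powr (real_of_int (k m) * (real CARD('n) - \<gamma>)))"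
      proof (rule sum_mono)
        fix m
        have "1 = 2 powr (real_of_int (k m) * (\<gamma> - real CARD('n))) * 2 powr (real_of_int (k m) * (real CARD('n) - \<gamma>))"
          by (simp add: algebra_simps flip: powr_add)
        also have "\<dots> \<le> real (N m) * 2 powr (real_of_int (k m) * (real CARD('n) - \<gamma>))"
          by (intro mult_right_mono N) auto
        finally show "1 \<le> real (N m) * 2 powr (real_of_int (k m) * (real CARD('n) - \<gamma>))" .
      qed
      also have "\<dots> = (\<Sum>a\<in>I. 2 powr (real_of_int (k (fst a)) * (real CARD('n) - \<gamma>)))"
        unfolding I_def by (rule sum_Sigma_fst[symmetric]) simp
      also have "\<dots> = (\<Sum>a\<in>I. dyadic_weight \<gamma> (Q a))"
        using dyadic_weight_eq[OF Q_cube, of \<gamma>] by (simp add: Q_def s_def)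
      also have "\<dots> = (\<Sum>Q\<in>Q ` I. sidelength Q powr (- \<gamma>) * measure lebesgue Q)"
        by (simp add: sum.reindex[OF inj] dyadic_weight_def)
      finally have "((\<kappa> / 2) powr p * real K) powr (1 / p) \<le>
          ((\<kappa> / 2) powr p * (\<Sum>Q\<in>Q ` I. sidelength Q powr (- \<gamma>) * measure lebesgue Q)) powr (1 / p)"
        using p by (intro powr_mono2 mult_left_mono) auto
      then have "ennreal (((\<kappa> / 2) powr p * real K) powr (1 / p)) \<le>
          ennreal (((\<kappa> / 2) powr p * (\<Sum>Q\<in>Q ` I. sidelength Q powr (- \<gamma>) * measure lebesgue Q)) powr (1 / p))"
        by (rule ennreal_leI)
      also have "\<dots> \<le> weak_seq_norm p \<gamma> (osc_seq p \<gamma> f)"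
        using \<kappa>(1) I p Q_cube osc by (intro weak_seq_norm_ge) auto
      finally show ?thesis .
    qed
    ultimately show "\<exists>f :: real ^ 'n \<Rightarrow> real. f \<in> L1_loc \<and> weak_Lp_norm p f \<le> ennreal ((2 * C) powr (1 / p)) \<and>
       ennreal (((\<kappa> / 2) powr p * real K) powr (1 / p)) \<le> weak_seq_norm p \<gamma> (osc_seq p \<gamma> f)"
      by blast
  qed
qed

section \<open>Sign changes and rearrangements\<close>

lemma const_in_L1_loc: "(\<lambda>x. c) \<in> L1_loc"
  by (auto simp: L1_loc_def absolutely_integrable_on_const lmeasurable_compact)

lemma weak_seq_norm_not_rearrangement_invariant:
  assumes "p > 0"
  shows "\<exists>f g :: real ^ 'n \<Rightarrow> real. f \<in> L1_loc \<and> g \<in> L1_loc \<and> same_distribution f g \<and>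
            weak_seq_norm p \<gamma> (osc_seq p \<gamma> f) \<noteq> weak_seq_norm p \<gamma> (osc_seq p \<gamma> g)"
proof -
  \<comment> \<open>On the unit cube all powers of the sidelength equal 1, whatever \<gamma> is, so
    one pair of functions serves every \<gamma>. The constant function has quasinorm 0, hence a
    single oscillating cube decides the matter.\<close>
  define Q :: "(real ^ 'n) set" where "Q = dyadic_cube 0 0"
  define R :: "(real ^ 'n) set" where "R = dyadic_child 0 0"
  define f :: "real ^ 'n \<Rightarrow> real" where "f = (\<lambda>_. 1)"
  define g :: "real ^ 'n \<Rightarrow> real" where "g = (\<lambda>x. 1 + (-2) * indicator R x)"
  have f: "f \<in> L1_loc" unfolding f_def by (rule const_in_L1_loc)
  have g: "g \<in> L1_loc"
  proof -
    have "(\<lambda>x. - 2 * indicator R x) \<in> L1_loc"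
      by (intro integrable_imp_L1_loc integrable_mult_right integrable_indicator_lmeasurable)
        (simp add: R_def dyadic_cubes_lmeasurable dyadic_child_in_dyadic_cubes)
    moreover have "(\<lambda>x :: real ^ 'n. 1) \<in> L1_loc" by (rule const_in_L1_loc)
    ultimately show ?thesis
      unfolding L1_loc_def g_def mem_Collect_eq by (intro allI impI set_integral_add(1)) simp_all
  qed
  have fg: "same_distribution f g"
  proof -
    have "\<bar>g x\<bar> = 1" for x by (simp add: g_def indicator_def)
    then show ?thesis by (simp add: same_distribution_def f_def)
  qed
  have "osc_seq p \<gamma> f Q = 0" if "Q \<in> dyadic_cubes" for Q
    using that mean_osc_const[of Q f 1]
    by (simp add: osc_seq_def f_def dyadic_cubes_lmeasurable measure_dyadic_cubes)
  then have empty: "{Q \<in> dyadic_cubes. \<bar>osc_seq p \<gamma> f Q\<bar> > t} = {}" if "t > 0" for t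
    using that by auto
  have "(SUP t\<in>{0<..}. ennreal (t powr p) * (\<Sum>\<^sub>\<infinity>Q\<in>{Q \<in> dyadic_cubes. \<bar>osc_seq p \<gamma> f Q\<bar> > t}.
             ennreal (sidelength Q powr (- \<gamma>) * measure lebesgue Q))) = 0"
  proof (intro antisym SUP_least)
    fix t :: real assume "t \<in> {0<..}"
    then show "ennreal (t powr p) * (\<Sum>\<^sub>\<infinity>Q\<in>{Q \<in> dyadic_cubes. \<bar>osc_seq p \<gamma> f Q\<bar> > t}.
             ennreal (sidelength Q powr (- \<gamma>) * measure lebesgue Q)) \<le> 0"
      by (simp only: empty greaterThan_iff infsum_empty mult_zero_right order_refl)
  qed simp
  then have f0: "weak_seq_norm p \<gamma> (osc_seq p \<gamma> f) = 0"
    unfolding weak_seq_norm_def by (simp add: ennreal_powr_def)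
  obtain \<kappa> where \<kappa>: "\<kappa> > 0" "\<And>(f :: real ^ 'n \<Rightarrow> real) a b k j.
       (\<And>x. x \<in> dyadic_cube k j \<Longrightarrow> f x = b + a * indicator (dyadic_child k j) x) \<Longrightarrow>
       mean_osc f (dyadic_cube k j) = \<bar>a\<bar> * \<kappa>"
    using mean_osc_child by blast
  have "mean_osc g Q = 2 * \<kappa>"
    using \<kappa>(2)[of 0 0 g 1 "-2"] by (simp add: g_def Q_def R_def)
  then have "\<bar>osc_seq p \<gamma> g Q\<bar> > \<kappa>"
    using \<kappa>(1) by (simp add: osc_seq_def Q_def sidelength_dyadic_cube)
  then have "ennreal ((\<kappa> powr p * (\<Sum>Q\<in>{Q}. sidelength Q powr (- \<gamma>) * measure lebesgue Q)) powr (1 / p))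
      \<le> weak_seq_norm p \<gamma> (osc_seq p \<gamma> g)"
    using \<kappa>(1) assms by (intro weak_seq_norm_ge) (auto simp: Q_def dyadic_cube_in_dyadic_cubes)
  moreover have "(\<kappa> powr p * (\<Sum>Q\<in>{Q}. sidelength Q powr (- \<gamma>) * measure lebesgue Q)) powr (1 / p) > 0"
    using \<kappa>(1) by (simp add: Q_def sidelength_dyadic_cube measure_dyadic_cube)
  ultimately have "weak_seq_norm p \<gamma> (osc_seq p \<gamma> g) \<noteq> 0"
    by auto
  with f g fg f0 show ?thesis by metis
qed

theorem claim7p2:
  fixes p \<gamma> :: real
  assumes "1 < p"
    and "\<gamma> \<notin> {0..real CARD('n::finite)}"
  shows "{f :: real ^ 'n \<Rightarrow> real. f \<in> L1_loc \<and> JN_norm p f < \<infinity>}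
           \<subset> {f. f \<in> L1_loc \<and> weak_seq_norm p \<gamma> (osc_seq p \<gamma> f) < \<infinity>}
      \<and> \<not> (\<exists>C::real. \<forall>f :: real ^ 'n \<Rightarrow> real. f \<in> L1_loc \<longrightarrow>
            JN_norm p f \<le> ennreal C * weak_seq_norm p \<gamma> (osc_seq p \<gamma> f))
      \<and> \<not> (\<exists>C::real. \<forall>f :: real ^ 'n \<Rightarrow> real. f \<in> L1_loc \<longrightarrow>
            weak_seq_norm p \<gamma> (osc_seq p \<gamma> f) \<le> ennreal C * weak_Lp_norm p f)
      \<and> (\<exists>f g :: real ^ 'n \<Rightarrow> real. f \<in> L1_loc \<and> g \<in> L1_loc \<and> same_distribution f g \<and>
            weak_seq_norm p \<gamma> (osc_seq p \<gamma> f) \<noteq> weak_seq_norm p \<gamma> (osc_seq p \<gamma> g))"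
proof (intro conjI)
  \<comment> \<open>One function settles both halves of (a): it witnesses properness, and no
    constant can make its finite sequence norm dominate its infinite $JN_p$ norm.\<close>
  let ?h = "lacunary_bumps p :: real ^ 'n \<Rightarrow> real"
  have h: "?h \<in> L1_loc" "JN_norm p ?h = \<infinity>" "weak_seq_norm p \<gamma> (osc_seq p \<gamma> ?h) < \<infinity>"
  proof -
    show "weak_seq_norm p \<gamma> (osc_seq p \<gamma> ?h) < \<infinity>"
      using assms by (intro weak_seq_norm_lacunary_bumps) auto
  qed (use assms in \<open>simp_all add: lacunary_bumps_L1_loc JN_norm_lacunary_bumps[simplified]\<close>)
  show "{f :: real ^ 'n \<Rightarrow> real. f \<in> L1_loc \<and> JN_norm p f < \<infinity>}
           \<subset> {f. f \<in> L1_loc \<and> weak_seq_norm p \<gamma> (osc_seq p \<gamma> f) < \<infinity>}"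
  proof (rule psubsetI)
    show "{f :: real ^ 'n \<Rightarrow> real. f \<in> L1_loc \<and> JN_norm p f < \<infinity>}
           \<subseteq> {f. f \<in> L1_loc \<and> weak_seq_norm p \<gamma> (osc_seq p \<gamma> f) < \<infinity>}"
      using weak_seq_norm_finite_if_JN_norm_finite[OF _ assms(2), of p] assms(1) by auto
    show "{f :: real ^ 'n \<Rightarrow> real. f \<in> L1_loc \<and> JN_norm p f < \<infinity>}
           \<noteq> {f. f \<in> L1_loc \<and> weak_seq_norm p \<gamma> (osc_seq p \<gamma> f) < \<infinity>}"
      using h by (metis (mono_tags, lifting) less_irrefl mem_Collect_eq)
  qed
  show "\<not> (\<exists>C::real. \<forall>f :: real ^ 'n \<Rightarrow> real. f \<in> L1_loc \<longrightarrow>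
            JN_norm p f \<le> ennreal C * weak_seq_norm p \<gamma> (osc_seq p \<gamma> f))"
  proof
    assume "\<exists>C::real. \<forall>f :: real ^ 'n \<Rightarrow> real. f \<in> L1_loc \<longrightarrow>
            JN_norm p f \<le> ennreal C * weak_seq_norm p \<gamma> (osc_seq p \<gamma> f)"
    then obtain C where "JN_norm p ?h \<le> ennreal C * weak_seq_norm p \<gamma> (osc_seq p \<gamma> ?h)"
      using h(1) by blast
    moreover have "ennreal C * weak_seq_norm p \<gamma> (osc_seq p \<gamma> ?h) < \<infinity>"
      using h(3) by (simp add: ennreal_mult_less_top)
    ultimately show False using h(2) by simp
  qed
  show "\<not> (\<exists>C::real. \<forall>f :: real ^ 'n \<Rightarrow> real. f \<in> L1_loc \<longrightarrow>
            weak_seq_norm p \<gamma> (osc_seq p \<gamma> f) \<le> ennreal C * weak_Lp_norm p f)"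
  proof
    assume "\<exists>C::real. \<forall>f :: real ^ 'n \<Rightarrow> real. f \<in> L1_loc \<longrightarrow>
            weak_seq_norm p \<gamma> (osc_seq p \<gamma> f) \<le> ennreal C * weak_Lp_norm p f"
    then obtain C where C: "\<And>f :: real ^ 'n \<Rightarrow> real. f \<in> L1_loc \<Longrightarrow>
        weak_seq_norm p \<gamma> (osc_seq p \<gamma> f) \<le> ennreal C * weak_Lp_norm p f" by blast
    obtain c B where c: "c > 0" and B: "B > 0" and cB:
      "\<And>K :: nat. \<exists>f :: real ^ 'n \<Rightarrow> real. f \<in> L1_loc \<and> weak_Lp_norm p f \<le> ennreal (B powr (1 / p)) \<and>
         ennreal ((c * real K) powr (1 / p)) \<le> weak_seq_norm p \<gamma> (osc_seq p \<gamma> f)"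
      using weak_seq_norm_unbounded_over_weak_Lp[OF assms] by blast
    \<comment> \<open>As \<open>ennreal\<close> sends negative reals to 0, a negative
      \<open>C\<close> is covered by \<open>max C 0\<close>. The number \<open>K\<close> is then
      taken so large that c K exceeds D^p.\<close>
    define D where "D = max C 0 * B powr (1 / p)"
    have D: "D \<ge> 0" by (simp add: D_def)
    obtain K where K: "D powr p / c < real K" using reals_Archimedean2 by blast
    obtain f :: "real ^ 'n \<Rightarrow> real" where f: "f \<in> L1_loc" "weak_Lp_norm p f \<le> ennreal (B powr (1 / p))"
      "ennreal ((c * real K) powr (1 / p)) \<le> weak_seq_norm p \<gamma> (osc_seq p \<gamma> f)"
      using cB by blast
    have "ennreal ((c * real K) powr (1 / p)) \<le> ennreal C * weak_Lp_norm p f"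
      using f(3) C[OF f(1)] by (rule order_trans)
    also have "\<dots> \<le> ennreal (max C 0) * ennreal (B powr (1 / p))"
      using f(2) by (intro mult_mono ennreal_leI) auto
    also have "\<dots> = ennreal D" by (simp add: D_def ennreal_mult)
    finally have "(c * real K) powr (1 / p) \<le> D" using D by (simp add: ennreal_le_iff)
    then have "((c * real K) powr (1 / p)) powr p \<le> D powr p"
      using assms(1) by (intro powr_mono2) auto
    then have "c * real K \<le> D powr p" using assms(1) c by (simp add: powr_powr)
    with K c show False by (simp add: field_simps)
  qed
  show "\<exists>f g :: real ^ 'n \<Rightarrow> real. f \<in> L1_loc \<and> g \<in> L1_loc \<and> same_distribution f g \<and>
            weak_seq_norm p \<gamma> (osc_seq p \<gamma> f) \<noteq> weak_seq_norm p \<gamma> (osc_seq p \<gamma> g)"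
    using assms(1) by (intro weak_seq_norm_not_rearrangement_invariant) auto
qed

end
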